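(* Let $\Gamma_{\mathcal T}$ be an $\tilde A_2$-group with shape function $\delta:\Gamma_{\mathcal T}\to\mathbb{N}^2$. Let $\Lambda_{\mathcal T}=\{w\in\Gamma_{\mathcal T}:\delta(w)\ge\mathbf 1\}$ and $\Lambda_{\mathcal T}^0=\{u\in\Gamma_{\mathcal T}:\delta(u)=\mathbf 1\}$, with range and source maps $r,s:\Lambda_{\mathcal T}\to\Lambda_{\mathcal T}^0$ and maps $b,c:\Lambda_{\mathcal T}\to\Gamma_{\mathcal T}$ determined by the unique factorisations $w=r(w)b(w)=c(w)s(w)$ with $\delta(r(w))=\delta(s(w))=\mathbf 1$ and $\delta(b(w))=\delta(c(w))=\delta(w)-\mathbf 1$; with $d:\Lambda_{\mathcal T}\to\mathbb{N}^2$ given by $d(\lambda)=\delta(\lambda)-\mathbf 1$; and with composition $\lambda\circ\mu:=c(\lambda)s(\lambda)b(\mu)$ (product in $\Gamma_{\mathcal T}$) whenever $s(\lambda)=r(\mu)$. Then $(\Lambda_{\mathcal T},d)$ is a $2$-graph, and the maps $b,c:\Lambda_{\mathcal T}\to\Gamma_{\mathcal T}$ are $1$-cocycles.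
   Context: $\tilde A_2$-groups. A finite projective plane $(P,L)$ of order $q$ consists of finite sets $P$ (points), $L$ (lines), $|P|=|L|=q^2+q+1$, and an incidence relation $\in$ from $P$ to $L$ such that any two distinct points lie on exactly one common line, any two distinct lines contain exactly one common point, and there are four distinct points no three of which are on one line. Given a bijection $\lambda:P\to L$, a triella compatible with $\lambda$ is a set $\mathcal T\subset P\times P\times P$ such that: (T1) for $x,y\in P$ there exists $z\in P$ with $(x,y,z)\in\mathcal T$ iff $y\in\lambda(x)$; (T2) $(x,y,z)\in\mathcal T\Rightarrow(y,z,x)\in\mathcal T$; (T3) for $x,y\in P$ there is at most one $z\in P$ with $(x,y,z)\in\mathcal T$. The associated $\tilde A_2$-group is $\Gamma_{\mathcal T}=\langle a_x,\ x\in P\mid a_xa_ya_z=1\text{ for each }(x,y,z)\in\mathcal T\rangle$. Shape function. It is known that every $w\in\Gamma_{\mathcal T}$ can be written with unique $m,n\ge0$ and unique $x_i,y_j\in P$ as $w=a_{x_1}\cdots a_{x_m}a_{y_1}^{-1}\cdots a_{y_n}^{-1}$ where $x_{i+1}\notin\lambda(x_i)$ for $1\le i<m$, $y_j\notin\lambda(y_{j+1})$ for $1\le j<n$, and $x_m\ne y_1$ if $m,n\ge1$ (right normal form); with the same $m,n$, there are unique $t_j,s_i\in P$ with $w=a_{t_1}^{-1}\cdots a_{t_n}^{-1}a_{s_1}\cdots a_{s_m}$, $s_{i+1}\notin\lambda(s_i)$, $t_j\notin\lambda(t_{j+1})$, and $t_n\neq s_1$ if $m,n\ge1$ (left normal form).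 Both have minimal length among words in the generators and inverses representing $w$, and every minimal-length word representing $w$ has $m$ generators and $n$ inverses of generators. Define $\delta(w)=(m,n)\in\mathbb{N}^2$. Write $\mathbf 1=(1,1)$; $\le$ on $\mathbb{N}^2$ is coordinatewise. Unique factorisation: if $\delta(w)=m+n$ with $m,n\in\mathbb{N}^2$ there are unique $h,k\in\Gamma_{\mathcal T}$ with $w=hk$, $\delta(h)=m$, $\delta(k)=n$; this gives the factorisations defining $r,s,b,c$ (if $\delta(w)=\mathbf 1$ then $r(w)=s(w)=w$ and $b(w)=c(w)=1$). A $2$-graph is a small category $\Lambda$ (identified with its morphisms; objects identified with identity morphisms $\Lambda^0$) with a functor $d:\Lambda\to\mathbb{N}^2$ such that if $d(\lambda)=m+n$ there are unique $\mu,\nu$ with $d(\mu)=m$, $d(\nu)=n$, $\lambda=\mu\nu$; $\lambda\mu$ is defined iff $s(\lambda)=r(\mu)$. A $1$-cocycle is a functor from $\Lambda$ to a group. *)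

theory Defs
  imports "HOL-Algebra.Group" "HOL-Library.Product_Plus" "HOL-Library.Product_Order"
begin

section \<open>Projective planes and triellas\<close>

definition projective_plane ::
  "'p set \<Rightarrow> 'l set \<Rightarrow> ('p \<Rightarrow> 'l \<Rightarrow> bool) \<Rightarrow> nat \<Rightarrow> bool" where
  "projective_plane P L I q \<longleftrightarrow>
     finite P \<and> finite L \<and> card P = q\<^sup>2 + q + 1 \<and> card L = q\<^sup>2 + q + 1 \<and>
     (\<forall>x\<in>P. \<forall>y\<in>P. x \<noteq> y \<longrightarrow> (\<exists>!l. l \<in> L \<and> I x l \<and> I y l)) \<and>
     (\<forall>k\<in>L. \<forall>l\<in>L. k \<noteq> l \<longrightarrow> (\<exists>!x. x \<in> P \<and> I x k \<and> I x l)) \<and>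
     (\<exists>A\<subseteq>P. card A = 4 \<and>
        (\<forall>B\<subseteq>A. card B = 3 \<longrightarrow> \<not> (\<exists>l\<in>L. \<forall>x\<in>B. I x l)))"

definition triella ::
  "'p set \<Rightarrow> ('p \<Rightarrow> 'l \<Rightarrow> bool) \<Rightarrow> ('p \<Rightarrow> 'l) \<Rightarrow> ('p \<times> 'p \<times> 'p) set \<Rightarrow> bool" where
  "triella P I lam T \<longleftrightarrow>
     T \<subseteq> P \<times> P \<times> P \<and>
     (\<forall>x\<in>P. \<forall>y\<in>P. (\<exists>z\<in>P. (x, y, z) \<in> T) \<longleftrightarrow> I y (lam x)) \<and>
     (\<forall>x y z. (x, y, z) \<in> T \<longrightarrow> (y, z, x) \<in> T) \<and>
     (\<forall>x\<in>P. \<forall>y\<in>P. \<forall>z\<in>P. \<forall>z'\<in>P. (x, y, z) \<in> T \<longrightarrow> (x, y, z') \<in> T \<longrightarrow> z = z')"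


section \<open>Groups given by generators and relators\<close>

datatype 'x letter = Pos 'x | Neg 'x

definition words :: "'x set \<Rightarrow> 'x letter list set" where
  "words S = lists (Pos ` S \<union> Neg ` S)"

text \<open>The smallest congruence on the free monoid of words over \<open>S\<close> and its formal inverses
  that makes formal inverses inverse to each other and all relators trivial.\<close>

inductive pres_eq ::
  "'x set \<Rightarrow> 'x letter list set \<Rightarrow> 'x letter list \<Rightarrow> 'x letter list \<Rightarrow> bool"
  for S :: "'x set" and R :: "'x letter list set" where
  pos_neg: "x \<in> S \<Longrightarrow> pres_eq S R [Pos x, Neg x] []"
| neg_pos: "x \<in> S \<Longrightarrow> pres_eq S R [Neg x, Pos x] []"
| relator: "w \<in> R \<Longrightarrow> w \<in> words S \<Longrightarrow> pres_eq S R w []"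
| refl: "w \<in> words S \<Longrightarrow> pres_eq S R w w"
| sym: "pres_eq S R u v \<Longrightarrow> pres_eq S R v u"
| trans: "pres_eq S R u v \<Longrightarrow> pres_eq S R v w \<Longrightarrow> pres_eq S R u w"
| append: "pres_eq S R u u' \<Longrightarrow> pres_eq S R v v' \<Longrightarrow> pres_eq S R (u @ v) (u' @ v')"

definition pres_class ::
  "'x set \<Rightarrow> 'x letter list set \<Rightarrow> 'x letter list \<Rightarrow> 'x letter list set" where
  "pres_class S R w = {v. pres_eq S R w v}"

definition presented_group ::
  "'x set \<Rightarrow> 'x letter list set \<Rightarrow> 'x letter list set monoid" where
  "presented_group S R =
     \<lparr>carrier = pres_class S R ` words S,
      mult = (\<lambda>A B. {w. \<exists>u\<in>A. \<exists>v\<in>B. pres_eq S R (u @ v) w}),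
      one = pres_class S R []\<rparr>"

lemma words_append [simp]: "u @ v \<in> words S \<longleftrightarrow> u \<in> words S \<and> v \<in> words S"
  by (auto simp: words_def)

lemma words_Nil [simp]: "[] \<in> words S"
  by (simp add: words_def)

lemma pres_eq_words: "pres_eq S R u v \<Longrightarrow> u \<in> words S \<and> v \<in> words S"
  by (induction rule: pres_eq.induct) (auto simp: words_def)

lemma pres_class_eq_iff:
  "u \<in> words S \<Longrightarrow> pres_class S R u = pres_class S R v \<longleftrightarrow> pres_eq S R u v"
  unfolding pres_class_def using pres_eq.refl pres_eq.sym pres_eq.trans by blast

lemma pres_class_mult:
  assumes "u \<in> words S" "v \<in> words S"
  shows "pres_class S R u \<otimes>\<^bsub>presented_group S R\<^esub> pres_class S R v = pres_class S R (u @ v)"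
proof -
  have "pres_eq S R (u @ v) w"
    if "pres_eq S R u u'" "pres_eq S R v v'" "pres_eq S R (u' @ v') w" for u' v' w
    using that pres_eq.append pres_eq.trans by metis
  moreover have "\<exists>u'\<in>pres_class S R u. \<exists>v'\<in>pres_class S R v. pres_eq S R (u' @ v') w"
    if "pres_eq S R (u @ v) w" for w
    using that assms pres_eq.refl unfolding pres_class_def by blast
  ultimately show ?thesis
    by (auto simp: presented_group_def pres_class_def)
qed

lemma pres_left_inverse:
  assumes "u \<in> words S"
  shows "\<exists>v\<in>words S. pres_eq S R (v @ u) []"
  using assms
proof (induction u)
  case Nil
  then show ?case using pres_eq.refl[of "[]"] by force
next
  case (Cons l u)
  then have u: "u \<in> words S" and l: "l \<in> Pos ` S \<union> Neg ` S"
    by (auto simp: words_def)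
  obtain v where v: "v \<in> words S" "pres_eq S R (v @ u) []"
    using Cons.IH u by blast
  obtain l' where l': "[l'] \<in> words S" "pres_eq S R [l', l] []"
  proof -
    from l consider x where "x \<in> S" "l = Pos x" | x where "x \<in> S" "l = Neg x" by blast
    then show thesis
    proof cases
      case 1
      then show ?thesis using that[of "Neg x"] pres_eq.neg_pos[of x S R] by (simp add: words_def)
    next
      case 2
      then show ?thesis using that[of "Pos x"] pres_eq.pos_neg[of x S R] by (simp add: words_def)
    qed
  qed
  have "pres_eq S R ([l', l] @ u) u"
    using pres_eq.append[OF l'(2) pres_eq.refl[OF u]] by simp
  then have "pres_eq S R (v @ [l', l] @ u) (v @ u)"
    by (rule pres_eq.append[OF pres_eq.refl[OF v(1)]])
  then have "pres_eq S R ((v @ [l']) @ l # u) []"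
    using pres_eq.trans v(2) by fastforce
  then show ?case
    using v(1) l'(1) words_append by blast
qed

lemma group_presented_group: "group (presented_group S R)"
proof (rule groupI)
  let ?G = "presented_group S R"
  have car: "carrier ?G = pres_class S R ` words S" and one: "\<one>\<^bsub>?G\<^esub> = pres_class S R []"
    by (simp_all add: presented_group_def)
  show "\<one>\<^bsub>?G\<^esub> \<in> carrier ?G"
    by (simp add: car one)
  show "x \<otimes>\<^bsub>?G\<^esub> y \<in> carrier ?G" if "x \<in> carrier ?G" "y \<in> carrier ?G" for x y
    using that by (auto simp: car pres_class_mult)
  show "x \<otimes>\<^bsub>?G\<^esub> y \<otimes>\<^bsub>?G\<^esub> z = x \<otimes>\<^bsub>?G\<^esub> (y \<otimes>\<^bsub>?G\<^esub> z)"
    if "x \<in> carrier ?G" "y \<in> carrier ?G" "z \<in> carrier ?G" for x y z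
    using that by (auto simp: car pres_class_mult)
  show "\<one>\<^bsub>?G\<^esub> \<otimes>\<^bsub>?G\<^esub> x = x" if "x \<in> carrier ?G" for x
    using that by (auto simp: car one pres_class_mult)
  show "\<exists>y\<in>carrier ?G. y \<otimes>\<^bsub>?G\<^esub> x = \<one>\<^bsub>?G\<^esub>" if x: "x \<in> carrier ?G" for x
  proof -
    obtain u where u: "u \<in> words S" "x = pres_class S R u"
      using x car by auto
    obtain v where v: "v \<in> words S" "pres_eq S R (v @ u) []"
      using pres_left_inverse u(1) by blast
    then show ?thesis
      using u by (auto simp: car one pres_class_mult pres_class_eq_iff intro!: bexI[of _ v])
  qed
qed


section \<open>The group of a triella and its shape function\<close>

definition tri_relators :: "('p \<times> 'p \<times> 'p) set \<Rightarrow> 'p letter list set" where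
  "tri_relators T = {[Pos x, Pos y, Pos z] | x y z. (x, y, z) \<in> T}"

definition tri_group :: "'p set \<Rightarrow> ('p \<times> 'p \<times> 'p) set \<Rightarrow> 'p letter list set monoid" where
  "tri_group P T = presented_group P (tri_relators T)"

definition tri_gen :: "'p set \<Rightarrow> ('p \<times> 'p \<times> 'p) set \<Rightarrow> 'p \<Rightarrow> 'p letter list set" where
  "tri_gen P T x = pres_class P (tri_relators T) [Pos x]"

definition right_normal ::
  "'p set \<Rightarrow> ('p \<Rightarrow> 'l \<Rightarrow> bool) \<Rightarrow> ('p \<Rightarrow> 'l) \<Rightarrow> 'p list \<Rightarrow> 'p list \<Rightarrow> bool" where
  "right_normal P I lam xs ys \<longleftrightarrow>
     set xs \<subseteq> P \<and> set ys \<subseteq> P \<and>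
     (\<forall>i. Suc i < length xs \<longrightarrow> \<not> I (xs ! Suc i) (lam (xs ! i))) \<and>
     (\<forall>j. Suc j < length ys \<longrightarrow> \<not> I (ys ! j) (lam (ys ! Suc j))) \<and>
     (xs \<noteq> [] \<and> ys \<noteq> [] \<longrightarrow> last xs \<noteq> hd ys)"

definition normal_word ::
  "'p set \<Rightarrow> ('p \<times> 'p \<times> 'p) set \<Rightarrow> 'p list \<Rightarrow> 'p list \<Rightarrow> 'p letter list set" where
  "normal_word P T xs ys =
     (let G = tri_group P T; a = tri_gen P T
      in foldr (\<otimes>\<^bsub>G\<^esub>) (map a xs @ map (\<lambda>y. inv\<^bsub>G\<^esub> (a y)) ys) \<one>\<^bsub>G\<^esub>)"

definition shape ::
  "'p set \<Rightarrow> ('p \<Rightarrow> 'l \<Rightarrow> bool) \<Rightarrow> ('p \<Rightarrow> 'l) \<Rightarrow> ('p \<times> 'p \<times> 'p) set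
     \<Rightarrow> 'p letter list set \<Rightarrow> nat \<times> nat" where
  "shape P I lam T w =
     (THE mn. \<exists>xs ys. right_normal P I lam xs ys \<and> w = normal_word P T xs ys \<and>
                      mn = (length xs, length ys))"


section \<open>The data of the 2-graph\<close>

definition Lam ::
  "'p set \<Rightarrow> ('p \<Rightarrow> 'l \<Rightarrow> bool) \<Rightarrow> ('p \<Rightarrow> 'l) \<Rightarrow> ('p \<times> 'p \<times> 'p) set
     \<Rightarrow> 'p letter list set set" where
  "Lam P I lam T = {w \<in> carrier (tri_group P T). shape P I lam T w \<ge> (1, 1)}"

definition Lam0 ::
  "'p set \<Rightarrow> ('p \<Rightarrow> 'l \<Rightarrow> bool) \<Rightarrow> ('p \<Rightarrow> 'l) \<Rightarrow> ('p \<times> 'p \<times> 'p) set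
     \<Rightarrow> 'p letter list set set" where
  "Lam0 P I lam T = {u \<in> carrier (tri_group P T). shape P I lam T u = (1, 1)}"

text \<open>\<open>(h, k)\<close> is the factorisation \<open>w = h k\<close> with \<open>h\<close> of shape \<open>m\<close> and \<open>k\<close> of shape \<open>n\<close>.\<close>

definition shape_factors ::
  "'p set \<Rightarrow> ('p \<Rightarrow> 'l \<Rightarrow> bool) \<Rightarrow> ('p \<Rightarrow> 'l) \<Rightarrow> ('p \<times> 'p \<times> 'p) set
     \<Rightarrow> nat \<times> nat \<Rightarrow> nat \<times> nat
     \<Rightarrow> 'p letter list set \<Rightarrow> 'p letter list set \<times> 'p letter list set" where
  "shape_factors P I lam T m n w =
     (THE (h, k). h \<in> carrier (tri_group P T) \<and> k \<in> carrier (tri_group P T) \<and>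
                  w = h \<otimes>\<^bsub>tri_group P T\<^esub> k \<and>
                  shape P I lam T h = m \<and> shape P I lam T k = n)"

definition r_map where
  "r_map P I lam T w = fst (shape_factors P I lam T (1, 1) (shape P I lam T w - (1, 1)) w)"

definition b_map where
  "b_map P I lam T w = snd (shape_factors P I lam T (1, 1) (shape P I lam T w - (1, 1)) w)"

definition c_map where
  "c_map P I lam T w = fst (shape_factors P I lam T (shape P I lam T w - (1, 1)) (1, 1) w)"

definition s_map where
  "s_map P I lam T w = snd (shape_factors P I lam T (shape P I lam T w - (1, 1)) (1, 1) w)"

definition deg where
  "deg P I lam T w = shape P I lam T w - (1, 1)"

definition comp_map where
  "comp_map P I lam T v w =
     c_map P I lam T v \<otimes>\<^bsub>tri_group P T\<^esub> s_map P I lam T v \<otimes>\<^bsub>tri_group P T\<^esub> b_map P I lam T w"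


section \<open>2-graphs and cocycles\<close>

text \<open>A small category is given by its set \<open>Mor\<close> of morphisms, the objects being identified
  with the identity morphisms \<open>Obj\<close>.  The value of \<open>cmp l m\<close> is only meaningful if
  \<open>src l = rng m\<close>.\<close>

locale small_category =
  fixes Mor Obj :: "'m set" and rng src :: "'m \<Rightarrow> 'm" and cmp :: "'m \<Rightarrow> 'm \<Rightarrow> 'm"
  assumes Obj_subset: "Obj \<subseteq> Mor"
    and rng_Obj: "l \<in> Mor \<Longrightarrow> rng l \<in> Obj"
    and src_Obj: "l \<in> Mor \<Longrightarrow> src l \<in> Obj"
    and rng_id: "v \<in> Obj \<Longrightarrow> rng v = v"
    and src_id: "v \<in> Obj \<Longrightarrow> src v = v"
    and cmp_closed: "l \<in> Mor \<Longrightarrow> m \<in> Mor \<Longrightarrow> src l = rng m \<Longrightarrow> cmp l m \<in> Mor"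
    and rng_cmp: "l \<in> Mor \<Longrightarrow> m \<in> Mor \<Longrightarrow> src l = rng m \<Longrightarrow> rng (cmp l m) = rng l"
    and src_cmp: "l \<in> Mor \<Longrightarrow> m \<in> Mor \<Longrightarrow> src l = rng m \<Longrightarrow> src (cmp l m) = src m"
    and cmp_assoc: "l \<in> Mor \<Longrightarrow> m \<in> Mor \<Longrightarrow> n \<in> Mor \<Longrightarrow> src l = rng m \<Longrightarrow> src m = rng n \<Longrightarrow>
                      cmp (cmp l m) n = cmp l (cmp m n)"
    and cmp_id_left: "l \<in> Mor \<Longrightarrow> cmp (rng l) l = l"
    and cmp_id_right: "l \<in> Mor \<Longrightarrow> cmp l (src l) = l"

locale two_graph = small_category Mor Obj rng src cmp
  for Mor Obj :: "'m set" and rng src :: "'m \<Rightarrow> 'm" and cmp :: "'m \<Rightarrow> 'm \<Rightarrow> 'm" +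
  fixes d :: "'m \<Rightarrow> nat \<times> nat"
  assumes d_id: "v \<in> Obj \<Longrightarrow> d v = 0"
    and d_cmp: "l \<in> Mor \<Longrightarrow> m \<in> Mor \<Longrightarrow> src l = rng m \<Longrightarrow> d (cmp l m) = d l + d m"
    and factorisation: "l \<in> Mor \<Longrightarrow> d l = p + q \<Longrightarrow>
          \<exists>!(m, n). m \<in> Mor \<and> n \<in> Mor \<and> src m = rng n \<and> d m = p \<and> d n = q \<and> l = cmp m n"

locale one_cocycle =
  small_category Mor Obj rng src cmp + group G
  for Mor Obj :: "'m set" and rng src :: "'m \<Rightarrow> 'm" and cmp :: "'m \<Rightarrow> 'm \<Rightarrow> 'm"
    and G :: "('g, 'e) monoid_scheme" (structure) +
  fixes f :: "'m \<Rightarrow> 'g"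
  assumes f_closed: "l \<in> Mor \<Longrightarrow> f l \<in> carrier G"
    and f_id: "v \<in> Obj \<Longrightarrow> f v = \<one>"
    and f_cmp: "l \<in> Mor \<Longrightarrow> m \<in> Mor \<Longrightarrow> src l = rng m \<Longrightarrow> f (cmp l m) = f l \<otimes> f m"

end

theory Submission
  imports Defs
begin

text \<open>
  Orienting the relations as length-decreasing rules together with the commutations
  \<open>a\<^sub>t\<^sup>-\<^sup>1 a\<^sub>s \<rightarrow> a\<^sub>x a\<^sub>y\<^sup>-\<^sup>1\<close> gives a terminating, locally confluent rewriting system whose
  irreducible words are the right normal forms; the only rules that preserve length are the
  commutations, and these preserve the shape.  So the shape is well defined and length is
  subadditive, with equality exactly when the shape is additive.  A left normal form is turned
  into a right normal form of the same shape by filling a rectangular grid of commutation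
  squares, and a grid is determined by either of its two boundary paths; this gives unique
  factorisation.  Filling grids also shows that if \<open>c u\<close> and \<open>u b\<close> have additive shapes and
  \<open>u\<close> has shape \<open>(1, 1)\<close>, then \<open>c u b\<close> has additive shape.  From these properties of the shape
  alone the \<open>2\<close>-graph axioms and the cocycle identities follow, since the composite of
  \<open>\<lambda> = c u\<close> and \<open>\<mu> = u b\<close> is \<open>c u b\<close>.
\<close>

section \<open>Abstract rewriting and letter counts of words\<close>

lemma newman:
  assumes wf: "wfP R\<inverse>\<inverse>"
    and loc: "\<And>a b c. R a b \<Longrightarrow> R a c \<Longrightarrow> \<exists>d. R\<^sup>*\<^sup>* b d \<and> R\<^sup>*\<^sup>* c d"
  shows "R\<^sup>*\<^sup>* a b \<Longrightarrow> R\<^sup>*\<^sup>* a c \<Longrightarrow> \<exists>d. R\<^sup>*\<^sup>* b d \<and> R\<^sup>*\<^sup>* c d"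
  using wf
proof (induction a arbitrary: b c rule: wfp_induct_rule)
  case (less a)
  show ?case
  proof (cases "a = b \<or> a = c")
    case True
    then show ?thesis using less.prems by blast
  next
    case False
    obtain b1 where b1: "R a b1" "R\<^sup>*\<^sup>* b1 b"
      using less.prems(1) False by (metis converse_rtranclpE)
    obtain c1 where c1: "R a c1" "R\<^sup>*\<^sup>* c1 c"
      using less.prems(2) False by (metis converse_rtranclpE)
    \<comment> \<open>Local confluence joins the two first steps at \<open>d\<close>. The induction
      hypothesis at \<open>b1\<close>, and then at \<open>c1\<close>, carries a common reduct over
      to \<open>b\<close> and \<open>c\<close>.\<close>
    obtain d where d: "R\<^sup>*\<^sup>* b1 d" "R\<^sup>*\<^sup>* c1 d"
      using loc b1(1) c1(1) by blast
    obtain e where e: "R\<^sup>*\<^sup>* b e" "R\<^sup>*\<^sup>* d e"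
      using less.IH[of b1 b d] b1 d(1) by blast
    obtain f where f: "R\<^sup>*\<^sup>* e f" "R\<^sup>*\<^sup>* c f"
      using less.IH[of c1 e c] c1 d(2) e(2) by (meson conversep.intros rtranclp_trans)
    show ?thesis using e f by (meson rtranclp_trans)
  qed
qed

text \<open>Rewriting happens at a factor \<open>a # b\<close> in a context, while normal forms are
  stated for neighbouring letters; this translates between the two.\<close>

lemma successively_iff_factors:
  "successively Q w \<longleftrightarrow> (\<forall>l a b r. w = l @ a # b # r \<longrightarrow> Q a b)"
proof (induction w rule: induct_list012)
  case (3 x y zs)
  show ?case
  proof
    assume "successively Q (x # y # zs)"
    then show "\<forall>l a b r. x # y # zs = l @ a # b # r \<longrightarrow> Q a b"
      using successively_append_iff[of Q] by (metis successively.simps(3))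
  next
    assume *: "\<forall>l a b r. x # y # zs = l @ a # b # r \<longrightarrow> Q a b"
    have "Q a b" if "y # zs = l @ a # b # r" for l a b r
      using *[rule_format, of "x # l"] that by auto
    then have "successively Q (y # zs)"
      using 3(2) by blast
    then show "successively Q (x # y # zs)"
      using *[rule_format, of "[]"] by simp
  qed
qed (auto simp: Cons_eq_append_conv)

definition size_of :: "nat \<times> nat \<Rightarrow> nat" where
  "size_of n = fst n + snd n"

lemma map_in_words [simp]:
  "map Pos xs \<in> words S \<longleftrightarrow> set xs \<subseteq> S" "map Neg xs \<in> words S \<longleftrightarrow> set xs \<subseteq> S"
  by (auto simp: words_def lists_eq_set)

lemma Cons_in_words [simp]:
  "Pos x # w \<in> words S \<longleftrightarrow> x \<in> S \<and> w \<in> words S" "Neg x # w \<in> words S \<longleftrightarrow> x \<in> S \<and> w \<in> words S"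
  by (auto simp: words_def)

fun npos :: "'a letter list \<Rightarrow> nat" where
  "npos [] = 0" | "npos (Pos _ # w) = Suc (npos w)" | "npos (Neg _ # w) = npos w"

fun nneg :: "'a letter list \<Rightarrow> nat" where
  "nneg [] = 0" | "nneg (Pos _ # w) = nneg w" | "nneg (Neg _ # w) = Suc (nneg w)"

text \<open>Counts pairs of an inverse letter standing anywhere before a generator. A commutation
  keeps the length and lowers this number, so it is the second component of the termination
  measure.\<close>

fun inversions :: "'a letter list \<Rightarrow> nat" where
  "inversions [] = 0"
| "inversions (Pos _ # w) = inversions w"
| "inversions (Neg _ # w) = npos w + inversions w"

lemma npos_append [simp]: "npos (u @ v) = npos u + npos v"
  by (induction u rule: npos.induct) auto

lemma nneg_append [simp]: "nneg (u @ v) = nneg u + nneg v"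
  by (induction u rule: npos.induct) auto

lemma inversions_append [simp]:
  "inversions (u @ v) = inversions u + inversions v + nneg u * npos v"
  by (induction u rule: npos.induct) auto

lemma npos_map [simp]: "npos (map Pos xs) = length xs" "npos (map Neg xs) = 0"
  "nneg (map Pos xs) = 0" "nneg (map Neg xs) = length xs"
  by (induction xs) auto


section \<open>The rewriting system\<close>

text \<open>The plane enters through \<open>T\<close> alone: some \<open>(x, u, z) \<in> T\<close>
  exists iff the point \<open>u\<close> lies on the line attached to \<open>x\<close>. Thus
  \<open>meet\<close> gives intersection points, \<open>join\<close> gives joining lines, and
  \<open>meet_unique\<close> says that distinct lines share at most one point.\<close>

locale triangle_presentation =
  fixes P :: "'p set" and T :: "('p \<times> 'p \<times> 'p) set"
  assumes T_subset: "(x, y, z) \<in> T \<Longrightarrow> x \<in> P \<and> y \<in> P \<and> z \<in> P"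
    and T_cycle: "(x, y, z) \<in> T \<Longrightarrow> (y, z, x) \<in> T"
    and T_unique: "(x, y, z) \<in> T \<Longrightarrow> (x, y, z') \<in> T \<Longrightarrow> z = z'"
    and meet: "x \<in> P \<Longrightarrow> x' \<in> P \<Longrightarrow> x \<noteq> x' \<Longrightarrow> \<exists>u z z'. (x, u, z) \<in> T \<and> (x', u, z') \<in> T"
    and join: "y \<in> P \<Longrightarrow> y' \<in> P \<Longrightarrow> y \<noteq> y' \<Longrightarrow> \<exists>u z z'. (u, y, z) \<in> T \<and> (u, y', z') \<in> T"
    and meet_unique: "(x, u, z1) \<in> T \<Longrightarrow> (x', u, z2) \<in> T \<Longrightarrow> (x, v, z3) \<in> T \<Longrightarrow> (x', v, z4) \<in> T
                        \<Longrightarrow> x = x' \<or> u = v"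
begin

lemma T_cycle': "(x, y, z) \<in> T \<Longrightarrow> (z, x, y) \<in> T"
  using T_cycle by blast

text \<open>\<open>J x y\<close> stands for \<open>y \<in> \<lambda>(x)\<close>.\<close>

definition J :: "'p \<Rightarrow> 'p \<Rightarrow> bool" where
  "J x y \<longleftrightarrow> (\<exists>z. (x, y, z) \<in> T)"

text \<open>\<open>square t s x y\<close> records the relation \<open>t\<^sup>-\<^sup>1 s = x y\<^sup>-\<^sup>1\<close> between generators.\<close>

definition square :: "'p \<Rightarrow> 'p \<Rightarrow> 'p \<Rightarrow> 'p \<Rightarrow> bool" where
  "square t s x y \<longleftrightarrow> t \<noteq> s \<and> (\<exists>u. (u, t, x) \<in> T \<and> (u, s, y) \<in> T)"

lemma squareI: "(u, t, x) \<in> T \<Longrightarrow> (u, s, y) \<in> T \<Longrightarrow> t \<noteq> s \<Longrightarrow> square t s x y"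
  unfolding square_def by blast

lemma square_exists: "t \<in> P \<Longrightarrow> s \<in> P \<Longrightarrow> t \<noteq> s \<Longrightarrow> \<exists>x y. square t s x y"
  unfolding square_def using join by blast

text \<open>Dual to \<open>square_exists\<close>: rotating the triples turns \<open>x\<close> and
  \<open>y\<close> into lines, and the apex \<open>u\<close> is their common point instead of the
  line joining \<open>t\<close> and \<open>s\<close>.\<close>

lemma square_exists_back: "x \<in> P \<Longrightarrow> y \<in> P \<Longrightarrow> x \<noteq> y \<Longrightarrow> \<exists>t s. square t s x y"
proof -
  assume "x \<in> P" "y \<in> P" "x \<noteq> y"
  then obtain u t s where u: "(x, u, t) \<in> T" "(y, u, s) \<in> T"
    using meet by blast
  then have v: "(u, t, x) \<in> T" "(u, s, y) \<in> T"
    using T_cycle by blast+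
  then have "t \<noteq> s" using T_unique \<open>x \<noteq> y\<close> by blast
  then show ?thesis using v squareI by blast
qed

lemma square_in_P: "square t s x y \<Longrightarrow> t \<in> P \<and> s \<in> P \<and> x \<in> P \<and> y \<in> P"
  unfolding square_def using T_subset by blast

lemma square_neq: "square t s x y \<Longrightarrow> t \<noteq> s \<and> x \<noteq> y"
  unfolding square_def using T_cycle T_unique by meson

text \<open>Two different apexes would be two lines through the distinct points \<open>t\<close> and
  \<open>s\<close>.\<close>

lemma square_unique: "square t s x y \<Longrightarrow> square t s x' y' \<Longrightarrow> x = x' \<and> y = y'"
  unfolding square_def by (metis T_unique meet_unique)

lemma square_unique_back: "square t s x y \<Longrightarrow> square t' s' x y \<Longrightarrow> t = t' \<and> s = s'"
proof -
  assume a: "square t s x y" "square t' s' x y"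
  then obtain u v where "(u, t, x) \<in> T" "(u, s, y) \<in> T" "(v, t', x) \<in> T" "(v, s', y) \<in> T"
    unfolding square_def by blast
  then have "(x, u, t) \<in> T" "(y, u, s) \<in> T" "(x, v, t') \<in> T" "(y, v, s') \<in> T"
    using T_cycle by blast+
  then show ?thesis using meet_unique T_unique square_neq[OF a(1)] by metis
qed

text \<open>\<open>PP\<close> and \<open>NN\<close> use a relator to trade two letters for one of
  the opposite sign. The triple in \<open>NN\<close> lists the letters backwards because inversion
  reverses products: \<open>z y u = 1\<close> gives \<open>y^-1 z^-1 = (z y)^-1 = u\<close>.\<close>

inductive rule :: "'p letter \<Rightarrow> 'p letter \<Rightarrow> 'p letter list \<Rightarrow> bool" where
  PN: "x \<in> P \<Longrightarrow> rule (Pos x) (Neg x) []"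
| NP: "x \<in> P \<Longrightarrow> rule (Neg x) (Pos x) []"
| PP: "(x, y, z) \<in> T \<Longrightarrow> rule (Pos x) (Pos y) [Neg z]"
| NN: "(z, y, u) \<in> T \<Longrightarrow> rule (Neg y) (Neg z) [Pos u]"
| swap: "square t s x y \<Longrightarrow> rule (Neg t) (Pos s) [Pos x, Neg y]"

inductive step :: "'p letter list \<Rightarrow> 'p letter list \<Rightarrow> bool" where
  "rule a b v \<Longrightarrow> step (l @ a # b # r) (l @ v @ r)"

abbreviation "steps \<equiv> step\<^sup>*\<^sup>*"

lemma step_context: "step u v \<Longrightarrow> step (l @ u @ r) (l @ v @ r)"
proof (induction rule: step.induct)
  case (1 a b v l' r')
  then show ?case using step.intros[of a b v "l @ l'" "r' @ r"] by simp
qed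

lemma steps_context: "steps u v \<Longrightarrow> steps (l @ u @ r) (l @ v @ r)"
  by (induction rule: rtranclp_induct) (auto intro: step_context rtranclp.rtrancl_into_rtrancl)

lemma steps_append: "steps u u' \<Longrightarrow> steps v v' \<Longrightarrow> steps (u @ v) (u' @ v')"
  using steps_context[of u u' "[]" v] steps_context[of v v' u' "[]"] by simp

lemma rule_steps: "rule a b v \<Longrightarrow> steps (l @ a # b # r) (l @ v @ r)"
  using step.intros by blast

lemma rule_steps0: "rule a b v \<Longrightarrow> steps (a # b # r) (v @ r)"
  using rule_steps[of a b v "[]"] by simp

lemma rule_steps1: "rule a b v \<Longrightarrow> steps (c # a # b # r) (c # v @ r)"
  using rule_steps[of a b v "[c]"] by simp

text \<open>Left-hand sides have two letters, so distinct overlapping redexes share exactly one. The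
  overlaps of \<open>PP\<close> with \<open>PP\<close> and of \<open>NN\<close> with
  \<open>NN\<close> are closed by \<open>swap\<close>, with the shared letter as apex; the other
  overlaps close by following the triples around.\<close>

lemma critical_pair:
  assumes "rule a b v" "rule b c w"
  shows "\<exists>e. steps (v @ [c]) e \<and> steps (a # w) e"
  using assms(1)
proof cases
  case (PN x)
  from assms(2) show ?thesis
  proof cases
    case (NP y)
    then show ?thesis using PN by auto
  next
    case (NN z y u)
    then have "rule (Pos x) (Pos u) [Neg z]"
      using PN T_cycle T_cycle' rule.PP by blast
    then show ?thesis using PN NN rule_steps0[of a "Pos u" "[Neg z]" "[]"] by auto
  next
    case (swap t s p r)
    then obtain u where u: "(u, t, p) \<in> T" "(u, s, r) \<in> T" unfolding square_def by blast
    then have "rule a (Pos p) [Neg u]" "rule (Neg u) (Neg r) [Pos s]"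
      using PN swap T_cycle T_cycle' rule.PP rule.NN by blast+
    then have "steps (a # w) [Neg u, Neg r]" "steps [Neg u, Neg r] [Pos s]"
      using rule_steps0[of a "Pos p" "[Neg u]" "[Neg r]"]
        rule_steps0[of "Neg u" "Neg r" "[Pos s]" "[]"] swap
      by simp_all
    then have "steps (a # w) [Pos s]" by (rule rtranclp_trans)
    then show ?thesis using PN swap by auto
  qed (use PN in auto)
next
  case (NP x)
  from assms(2) show ?thesis
  proof cases
    case (PN y)
    then show ?thesis using NP by auto
  next
    case (PP x' y z)
    then have "rule (Neg x) (Neg z) [Pos y]"
      using NP T_cycle T_cycle' rule.NN by blast
    then show ?thesis using NP PP rule_steps0[of a "Neg z" "[Pos y]" "[]"] by auto
  qed (use NP in auto)
next
  case (PP x y z)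
  from assms(2) show ?thesis
  proof cases
    case (PN y')
    then have "rule (Neg z) (Neg y) [Pos x]"
      using PP T_cycle T_cycle' rule.NN by blast
    then show ?thesis using PN PP rule_steps0[of "Neg z" "Neg y" "[Pos x]" "[]"] by auto
  next
    case (PP y1 z1 v1)
    have T: "(y, z, x) \<in> T" "(y, z1, v1) \<in> T"
      using PP \<open>b = Pos y\<close> T_cycle[OF \<open>(x, y, z) \<in> T\<close>] by auto
    show ?thesis
    \<comment> \<open>A square needs distinct lower letters. In the degenerate case
      \<open>v1 = x\<close> as well, and both sides cancel to the empty word.\<close>
    proof (cases "z = z1")
      case True
      then have "v1 = x" using T T_unique by blast
      then have "rule (Neg z) (Pos z1) []" "rule (Pos x) (Neg v1) []"
        using rule.NP rule.PN T T_subset True by blast+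
      then show ?thesis
        using rule_steps0[of "Neg z" "Pos z1" _ "[]"]  rule_steps0[of "Pos x" "Neg v1" _ "[]"]
          PP \<open>a = Pos x\<close> \<open>v = [Neg z]\<close> by auto
    next
      case False
      then have "rule (Neg z) (Pos z1) [Pos x, Neg v1]"
        using rule.swap squareI T by blast
      then show ?thesis
        using rule_steps0[of "Neg z" "Pos z1" _ "[]"] PP \<open>a = Pos x\<close> \<open>v = [Neg z]\<close> by auto
    qed
  qed (use PP in auto)
next
  case (NN y x u)
  from assms(2) show ?thesis
  proof cases
    case (NP y')
    then have "rule (Pos u) (Pos y) [Neg x]"
      using NN T_cycle T_cycle' rule.PP by blast
    then show ?thesis using NN NP rule_steps0[of "Pos u" "Pos y" _ "[]"] by auto
  next
    case (NN z y' p)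
    have T: "(y, x, u) \<in> T" "(y, p, z) \<in> T"
      using NN \<open>b = Neg y\<close> \<open>(y, x, u) \<in> T\<close> T_cycle by blast+
    show ?thesis
    proof (cases "x = p")
      case True
      then have "u = z" using T T_unique by blast
      then have "rule (Neg x) (Pos p) []" "rule (Pos u) (Neg z) []"
        using rule.NP rule.PN T T_subset True by blast+
      then show ?thesis
        using rule_steps0[of "Neg x" "Pos p" _ "[]"] rule_steps0[of "Pos u" "Neg z" _ "[]"]
          NN \<open>a = Neg x\<close> \<open>v = [Pos u]\<close> by auto
    next
      case False
      then have "rule (Neg x) (Pos p) [Pos u, Neg z]"
        using rule.swap squareI T by blast
      then show ?thesis
        using rule_steps0[of "Neg x" "Pos p" _ "[]"] NN \<open>a = Neg x\<close> \<open>v = [Pos u]\<close> by auto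
    qed
  next
    case (swap t s p r)
    then obtain k where k: "(k, t, p) \<in> T" "(k, s, r) \<in> T" unfolding square_def by blast
    have T: "(t, x, u) \<in> T" "(t, p, k) \<in> T"
      using swap \<open>b = Neg y\<close> \<open>(y, x, u) \<in> T\<close> k T_cycle T_cycle' by blast+
    have P1: "x \<in> P" using T T_subset by blast
    show ?thesis
    proof (cases "x = p")
      case True
      then have "u = k" using T T_unique by blast
      then have "rule (Pos u) (Pos s) [Neg r]" "rule (Neg x) (Pos p) []"
        using k rule.PP rule.NP P1 True by blast+
      then show ?thesis
        using rule_steps0[of "Pos u" "Pos s" "[Neg r]" "[]"]
          rule_steps0[of "Neg x" "Pos p" "[]" "[Neg r]"]
          swap \<open>a = Neg x\<close> \<open>v = [Pos u]\<close> by auto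
    next
      case False
      then have "rule (Neg x) (Pos p) [Pos u, Neg k]"
        using rule.swap squareI T by blast
      moreover have "rule (Neg k) (Neg r) [Pos s]"
        using rule.NN k T_cycle' by blast
      ultimately have "steps [Neg x, Pos p, Neg r] [Pos u, Pos s]"
        using rule_steps0[of "Neg x" "Pos p" "[Pos u, Neg k]" "[Neg r]"]
          rule_steps1[of "Neg k" "Neg r" "[Pos s]" "Pos u" "[]"] by auto
      then show ?thesis
        using swap \<open>a = Neg x\<close> \<open>v = [Pos u]\<close> by auto
    qed
  qed (use NN in auto)
next
  case (swap t s x y')
  then obtain k where k: "(k, t, x) \<in> T" "(k, s, y') \<in> T" unfolding square_def by blast
  from assms(2) show ?thesis
  proof cases
    case (PN y)
    then have s: "y = s" using swap by simp
    have "rule (Neg y') (Neg s) [Pos k]" "rule (Pos x) (Pos k) [Neg t]"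
      using k T_cycle T_cycle' rule.NN rule.PP by blast+
    then have "steps [Pos x, Neg y', Neg s] [Neg t]"
      using rule_steps1[of "Neg y'" "Neg s" "[Pos k]" "Pos x" "[]"]
        rule_steps0[of "Pos x" "Pos k" "[Neg t]" "[]"] by auto
    then show ?thesis using swap PN s by auto
  next
    case (PP s' y u)
    have T: "(s, y, u) \<in> T" "(s, y', k) \<in> T"
      using PP swap T_cycle[OF k(2)] by auto
    show ?thesis
    proof (cases "y' = y")
      case True
      then have "u = k" using T T_unique by blast
      then have "rule (Neg t) (Neg u) [Pos x]" "rule (Neg y') (Pos y) []"
        using k rule.NN rule.NP True T T_subset by blast+
      then show ?thesis
        using rule_steps0[of "Neg t" "Neg u" "[Pos x]" "[]"]
          rule_steps1[of "Neg y'" "Pos y" "[]" "Pos x" "[]"]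
          swap PP by auto
    next
      case False
      then have "rule (Neg y') (Pos y) [Pos k, Neg u]"
        using rule.swap squareI T by blast
      moreover have "rule (Pos x) (Pos k) [Neg t]"
        using rule.PP k T_cycle' by blast
      ultimately have "steps [Pos x, Neg y', Pos y] [Neg t, Neg u]"
        using rule_steps1[of "Neg y'" "Pos y" "[Pos k, Neg u]" "Pos x" "[]"]
          rule_steps0[of "Pos x" "Pos k" "[Neg t]" "[Neg u]"] by auto
      then show ?thesis using swap PP by auto
    qed
  qed (use swap in auto)
qed

lemma rule_unique: "rule a b v \<Longrightarrow> rule a b w \<Longrightarrow> v = w"
  by (auto elim!: rule.cases dest: T_unique square_unique square_neq)

section \<open>Confluence and termination\<close>

lemma local_confluence:
  assumes "step u v" "step u w"
  shows "\<exists>e. steps v e \<and> steps w e"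
proof -
  have *: "\<exists>e. steps (l @ v @ r) e \<and> steps (l' @ w @ r') e"
    if R: "rule a b v" "rule a' b' w" and eq: "l @ a # b # r = l' @ a' # b' # r'"
      and le: "length l \<le> length l'" for a b v a' b' w l r l' r'
  proof -
    \<comment> \<open>\<open>m\<close> is the offset between the redexes: empty means the same
      redex, one letter means a critical pair, and more letters mean disjoint redexes, whose
      rewrites commute.\<close>
    obtain m where l': "l' = l @ m" and m: "a # b # r = m @ a' # b' # r'"
      using eq le by (metis append_eq_append_conv_if append_eq_conv_conj append_take_drop_id)
    show ?thesis
    proof (cases m)
      case Nil
      then have "v = w" using m R rule_unique by auto
      then show ?thesis using m l' Nil by auto
    next
      case (Cons a1 m1)
      show ?thesis
      proof (cases m1)
        case Nil
        then have "a1 = a" "a' = b" "r = b' # r'" using m Cons by auto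
        moreover obtain e where "steps (v @ [b']) e" "steps (a # w) e"
          using critical_pair R calculation by blast
        ultimately show ?thesis
          using steps_context[of "v @ [b']" e l r'] steps_context[of "a # w" e l r'] l' Cons Nil
          by auto
      next
        case (Cons b1 m2)
        then have r: "r = m2 @ a' # b' # r'" and l2: "l' = l @ a # b # m2"
          using m l' \<open>m = a1 # m1\<close> by auto
        have "steps (l @ v @ r) (l @ v @ m2 @ w @ r')"
          using rule_steps[OF R(2), of "l @ v @ m2" r'] r by simp
        moreover have "steps (l' @ w @ r') (l @ v @ m2 @ w @ r')"
          using rule_steps[OF R(1), of l "m2 @ w @ r'"] l2 by simp
        ultimately show ?thesis by blast
      qed
    qed
  qed
  obtain a b v1 l r where 1: "rule a b v1" "u = l @ a # b # r" "v = l @ v1 @ r"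
    using assms(1) by (auto elim: step.cases)
  obtain a' b' w1 l' r' where 2: "rule a' b' w1" "u = l' @ a' # b' # r'" "w = l' @ w1 @ r'"
    using assms(2) by (auto elim: step.cases)
  show ?thesis
    using *[of a b v1 a' b' w1 l r l' r'] *[of a' b' w1 a b v1 l' r' l r] 1 2
    by (cases "length l \<le> length l'") auto
qed

text \<open>Only \<open>swap\<close> keeps the length, and it replaces one generator and one inverse
  by one of each. Besides termination, this later shows that length-preserving reductions keep the
  shape.\<close>

lemma step_measure: "step u v \<Longrightarrow> length v < length u \<or>
   length v = length u \<and> npos v = npos u \<and> nneg v = nneg u \<and> inversions v < inversions u"
  by (induction rule: step.induct, erule rule.cases) auto

lemma wfP_step: "wfP step\<inverse>\<inverse>"
proof -
  let ?R = "measures [length, inversions :: 'p letter list \<Rightarrow> nat]"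
  have "wfp (\<lambda>x y. (x, y) \<in> ?R)"
    using wf_measures by (simp only: wfp_wf_eq)
  moreover have "(u, v) \<in> ?R" if "step\<inverse>\<inverse> u v" for u v
    using step_measure[of v u] that by auto
  ultimately show ?thesis
    by (rule wfp_if_convertible_to_wfp[where f = "\<lambda>x. x"])
qed

lemma steps_confluent: "steps u v \<Longrightarrow> steps u w \<Longrightarrow> \<exists>e. steps v e \<and> steps w e"
  using newman[OF wfP_step] local_confluence by blast

lemma steps_measure: "steps u v \<Longrightarrow> length v < length u \<or>
   length v = length u \<and> npos v = npos u \<and> nneg v = nneg u"
proof (induction rule: rtranclp_induct)
  case (step y z)
  then show ?case using step_measure[of y z] by auto
qed simp

section \<open>Irreducible words are the right normal forms\<close>

definition irreducible :: "'p letter list \<Rightarrow> bool" where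
  "irreducible w \<longleftrightarrow> (\<nexists>v. step w v)"

abbreviation word :: "'p list \<Rightarrow> 'p list \<Rightarrow> 'p letter list" where
  "word xs ys \<equiv> map Pos xs @ map Neg ys"

text \<open>\<open>right_normal\<close> phrased through \<open>T\<close>, with \<open>J\<close> for
  incidence and \<open>successively\<close> for the index conditions; \<open>shape_eq_shp\<close>
  reconciles the two versions.\<close>

definition normal :: "'p list \<Rightarrow> 'p list \<Rightarrow> bool" where
  "normal xs ys \<longleftrightarrow> set xs \<subseteq> P \<and> set ys \<subseteq> P \<and>
     successively (\<lambda>x y. \<not> J x y) xs \<and> successively (\<lambda>x y. \<not> J y x) ys \<and>
     (xs \<noteq> [] \<and> ys \<noteq> [] \<longrightarrow> last xs \<noteq> hd ys)"

definition redex :: "'p letter \<Rightarrow> 'p letter \<Rightarrow> bool" where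
  "redex a b \<longleftrightarrow> (\<exists>v. rule a b v)"

lemma irreducible_iff_successively:
  "irreducible w \<longleftrightarrow> successively (\<lambda>a b. \<not> redex a b) w"
  unfolding irreducible_def successively_iff_factors redex_def by (auto simp: step.simps)

lemma redex_PP: "redex (Pos x) (Pos y) \<longleftrightarrow> J x y"
  by (auto simp: redex_def J_def rule.simps)

lemma redex_NN: "redex (Neg x) (Neg y) \<longleftrightarrow> J y x"
  by (auto simp: redex_def J_def rule.simps)

lemma redex_PN: "redex (Pos x) (Neg y) \<longleftrightarrow> x = y \<and> x \<in> P"
  by (auto simp: redex_def rule.simps)

lemma redex_NP: "redex (Neg x) (Pos y) \<longleftrightarrow> x \<in> P \<and> y \<in> P"
  using square_exists[of x y] by (auto simp: redex_def rule.simps dest: square_in_P)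

lemma irreducible_word_iff:
  assumes "set xs \<subseteq> P" "set ys \<subseteq> P"
  shows "irreducible (word xs ys) \<longleftrightarrow> normal xs ys"
proof (cases "xs = [] \<or> ys = []")
  case True
  then show ?thesis using assms
    by (auto simp: irreducible_iff_successively normal_def successively_append_iff successively_map
        redex_PP redex_NN)
next
  case False
  \<comment> \<open>At the junction of the two halves the only redex is a cancellation, and
    \<open>redex_PN\<close> asks for membership in \<open>P\<close>.\<close>
  then have "last xs \<in> P" using assms by auto
  then show ?thesis using assms False
    by (auto simp: irreducible_iff_successively normal_def successively_append_iff successively_map
        redex_PP redex_NN redex_PN last_map hd_map)
qed

text \<open>An inverse directly before a generator either cancels or commutes, so by
  \<open>redex_NP\<close> it is always a redex; hence all generators precede all inverses.\<close>

lemma irreducible_obtain_word: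
  assumes "irreducible w" "w \<in> words P"
  obtains xs ys where "w = word xs ys" "normal xs ys"
proof -
  have "\<exists>xs ys. w = word xs ys \<and> set xs \<subseteq> P \<and> set ys \<subseteq> P"
    using assms
  proof (induction w)
    case Nil
    show ?case by (rule exI[of _ "[]"], rule exI[of _ "[]"]) simp
  next
    case (Cons a w)
    then have "irreducible w" "w \<in> words P"
      by (auto simp: irreducible_iff_successively successively_Cons words_def)
    then obtain xs ys where w: "w = word xs ys" "set xs \<subseteq> P" "set ys \<subseteq> P"
      using Cons.IH by blast
    show ?case
    proof (cases a)
      case (Pos x)
      then have "a # w = word (x # xs) ys" "x \<in> P" using w Cons.prems by auto
      then show ?thesis using w by (metis insert_subset list.set(2))
    next
      case (Neg y)
      have y: "y \<in> P" using Neg Cons.prems by auto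
      have "xs = []"
      proof (cases xs)
        case (Cons x xs')
        then have "redex (Neg y) (Pos x)" using y w redex_NP by auto
        then show ?thesis using Cons.prems(1) Neg Cons w
          by (auto simp: irreducible_iff_successively)
      qed
      then have "a # w = word [] (y # ys)" using w Neg by simp
      then show ?thesis using w y by (metis empty_subsetI insert_subset list.set)
    qed
  qed
  then show thesis using that irreducible_word_iff assms(1) by metis
qed

lemma rule_words: "rule a b v \<Longrightarrow> v \<in> words P"
  by (auto elim!: rule.cases dest: T_subset square_in_P)

lemma steps_words: "steps u v \<Longrightarrow> u \<in> words P \<Longrightarrow> v \<in> words P"
proof (induction rule: rtranclp_induct)
  case (step v w)
  then show ?case using rule_words by (auto elim!: step.cases) (auto simp: words_def)
qed simp

lemma irreducible_exists: "\<exists>v. steps u v \<and> irreducible v"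
  using wfP_step
proof (induction u rule: wfp_induct_rule)
  case (less u)
  show ?case
  proof (cases "irreducible u")
    case False
    then obtain v where "step u v" unfolding irreducible_def by blast
    then show ?thesis using less[of v] by (meson conversepI converse_rtranclp_into_rtranclp)
  qed blast
qed

lemma irreducible_steps: "irreducible u \<Longrightarrow> steps u v \<Longrightarrow> u = v"
  unfolding irreducible_def by (metis converse_rtranclpE)


section \<open>Normal forms and the shape function\<close>

definition cls :: "'p letter list \<Rightarrow> 'p letter list set" where
  "cls = pres_class P (tri_relators T)"

abbreviation group_eq :: "'p letter list \<Rightarrow> 'p letter list \<Rightarrow> bool" where
  "group_eq \<equiv> pres_eq P (tri_relators T)"

lemma cls_eq_iff: "u \<in> words P \<Longrightarrow> cls u = cls v \<longleftrightarrow> group_eq u v"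
  unfolding cls_def by (rule pres_class_eq_iff)

lemma group_eq_context:
  "group_eq u v \<Longrightarrow> l \<in> words P \<Longrightarrow> r \<in> words P \<Longrightarrow> group_eq (l @ u @ r) (l @ v @ r)"
  by (intro pres_eq.append pres_eq.refl)

lemma group_eq_relator: "(x, y, z) \<in> T \<Longrightarrow> group_eq [Pos x, Pos y, Pos z] []"
  using T_subset by (intro pres_eq.relator) (auto simp: tri_relators_def)

lemma group_eq_PP:
  assumes "(x, y, z) \<in> T"
  shows "group_eq [Pos x, Pos y] [Neg z]"
proof -
  have P: "x \<in> P" "y \<in> P" "z \<in> P" using assms T_subset by auto
  have "group_eq ([Pos x, Pos y] @ [Pos z, Neg z] @ []) ([Pos x, Pos y] @ [] @ [])"
    using P by (intro group_eq_context pres_eq.pos_neg) auto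
  moreover have "group_eq ([] @ [Pos x, Pos y, Pos z] @ [Neg z]) ([] @ [] @ [Neg z])"
    using P by (intro group_eq_context group_eq_relator assms) auto
  ultimately show ?thesis
    using pres_eq.sym pres_eq.trans by fastforce
qed

lemma group_eq_NN:
  assumes "(z, y, u) \<in> T"
  shows "group_eq [Neg y, Neg z] [Pos u]"
proof -
  have P: "z \<in> P" "y \<in> P" "u \<in> P" using assms T_subset by auto
  have "group_eq ([Neg y, Neg z] @ [Pos z, Pos y, Pos u] @ []) ([Neg y, Neg z] @ [] @ [])"
    using P by (intro group_eq_context group_eq_relator assms) auto
  moreover have "group_eq ([Neg y] @ [Neg z, Pos z] @ [Pos y, Pos u]) ([Neg y] @ [] @ [Pos y, Pos u])"
    using P by (intro group_eq_context pres_eq.neg_pos) auto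
  moreover have "group_eq ([] @ [Neg y, Pos y] @ [Pos u]) ([] @ [] @ [Pos u])"
    using P by (intro group_eq_context pres_eq.neg_pos) auto
  ultimately show ?thesis
    using pres_eq.sym pres_eq.trans by (metis append.left_neutral append_Cons append_Nil2)
qed

text \<open>Insert \<open>y y^-1\<close> on the right; the apex gives \<open>s y = u^-1\<close> and
  \<open>t^-1 u^-1 = x\<close>.\<close>

lemma group_eq_square:
  assumes "square t s x y"
  shows "group_eq [Neg t, Pos s] [Pos x, Neg y]"
proof -
  obtain u where u: "(u, t, x) \<in> T" "(u, s, y) \<in> T" using assms square_def by blast
  have P: "t \<in> P" "s \<in> P" "x \<in> P" "y \<in> P" using assms square_in_P by auto
  have "group_eq ([Neg t, Pos s] @ [Pos y, Neg y] @ []) ([Neg t, Pos s] @ [] @ [])"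
    using P by (intro group_eq_context pres_eq.pos_neg) auto
  moreover have "group_eq ([Neg t] @ [Pos s, Pos y] @ [Neg y]) ([Neg t] @ [Neg u] @ [Neg y])"
    using P u T_cycle by (intro group_eq_context group_eq_PP) auto
  moreover have "group_eq ([] @ [Neg t, Neg u] @ [Neg y]) ([] @ [Pos x] @ [Neg y])"
    using P u by (intro group_eq_context group_eq_NN) auto
  ultimately show ?thesis
    using pres_eq.sym pres_eq.trans by (metis append.left_neutral append_Cons append_Nil2)
qed

lemma rule_group_eq: "rule a b v \<Longrightarrow> group_eq [a, b] v"
  by (erule rule.cases)
    (auto intro: pres_eq.pos_neg pres_eq.neg_pos group_eq_PP group_eq_NN group_eq_square)

lemma step_group_eq: "step u v \<Longrightarrow> u \<in> words P \<Longrightarrow> group_eq u v"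
proof (induction rule: step.induct)
  case (1 a b v l r)
  then have "l \<in> words P" "r \<in> words P" by (auto simp: words_def)
  then show ?case using group_eq_context[OF rule_group_eq[OF 1(1)]] by simp
qed

lemma steps_group_eq: "steps u v \<Longrightarrow> u \<in> words P \<Longrightarrow> group_eq u v"
proof (induction rule: rtranclp_induct)
  case base
  then show ?case by (rule pres_eq.refl)
next
  case (step v w)
  then show ?case using step_group_eq steps_words pres_eq.trans by blast
qed

lemma steps_cls: "steps u v \<Longrightarrow> u \<in> words P \<Longrightarrow> cls u = cls v"
  by (simp add: cls_eq_iff steps_group_eq)

text \<open>The Church-Rosser property, by induction on the congruence; confluence is used in the
  transitivity case.\<close>

lemma group_eq_joinable: "group_eq u v \<Longrightarrow> \<exists>w. steps u w \<and> steps v w"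
proof (induction rule: pres_eq.induct)
  case (pos_neg x)
  then show ?case using rule_steps0[OF rule.PN, of x "[]"] by auto
next
  case (neg_pos x)
  then show ?case using rule_steps0[OF rule.NP, of x "[]"] by auto
next
  case (relator w)
  then obtain x y z where w: "w = [Pos x, Pos y, Pos z]" "(x, y, z) \<in> T"
    by (auto simp: tri_relators_def)
  then have "steps [Pos x, Pos y, Pos z] [Neg z, Pos z]" "steps [Neg z, Pos z] []"
    using rule_steps0[OF rule.PP, of x y z "[Pos z]"] rule_steps0[OF rule.NP, of z "[]"] T_subset
    by auto
  then show ?case using w by (meson rtranclp_trans rtranclp.rtrancl_refl)
next
  case (trans u v w)
  then obtain a b where "steps u a" "steps v a" "steps v b" "steps w b" by blast
  moreover obtain c where "steps a c" "steps b c"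
    using steps_confluent calculation by blast
  ultimately show ?case by (meson rtranclp_trans)
next
  case (append u u' v v')
  then show ?case using steps_append by meson
qed auto

lemma irreducible_cls_unique:
  assumes "cls u = cls v" "irreducible u" "irreducible v" "u \<in> words P"
  shows "u = v"
  using assms cls_eq_iff group_eq_joinable irreducible_steps by metis

definition shp :: "'p letter list set \<Rightarrow> nat \<times> nat" where
  "shp w = (THE mn. \<exists>xs ys. normal xs ys \<and> w = cls (word xs ys) \<and> mn = (length xs, length ys))"

lemma word_eq_iff: "word xs ys = word xs' ys' \<longleftrightarrow> xs = xs' \<and> ys = ys'"
proof (induction xs arbitrary: xs')
  case Nil
  then show ?case by (cases xs'; cases ys) (auto simp: inj_map_eq_map inj_def)
next
  case (Cons x xs)
  then show ?case by (cases xs'; cases ys') auto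
qed

lemma normal_unique:
  assumes "cls (word xs ys) = cls (word xs' ys')" "normal xs ys" "normal xs' ys'"
  shows "xs = xs' \<and> ys = ys'"
proof -
  have "irreducible (word xs ys)" "irreducible (word xs' ys')"
    using assms irreducible_word_iff unfolding normal_def by blast+
  then have "word xs ys = word xs' ys'"
    using irreducible_cls_unique assms by (simp add: normal_def)
  then show ?thesis using word_eq_iff by simp
qed

lemma shp_normal: "normal xs ys \<Longrightarrow> shp (cls (word xs ys)) = (length xs, length ys)"
  unfolding shp_def by (rule the_equality) (auto dest: normal_unique)

lemma normal_form_exists:
  assumes "u \<in> words P"
  obtains xs ys where "normal xs ys" "steps u (word xs ys)" "cls u = cls (word xs ys)"
    "shp (cls u) = (length xs, length ys)"
proof -
  obtain v where v: "steps u v" "irreducible v" using irreducible_exists by blast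
  then obtain xs ys where "v = word xs ys" "normal xs ys"
    using irreducible_obtain_word steps_words assms by metis
  then show thesis using that v steps_cls shp_normal assms by metis
qed

text \<open>Reduction to normal form never lengthens a word, and if it keeps the length, then it
  keeps both letter counts.\<close>

lemma shp_word:
  assumes "u \<in> words P"
  shows "size_of (shp (cls u)) \<le> length u"
    and "size_of (shp (cls u)) = length u \<Longrightarrow> shp (cls u) = (npos u, nneg u)"
proof -
  obtain xs ys where "steps u (word xs ys)" "shp (cls u) = (length xs, length ys)"
    using normal_form_exists assms by metis
  then show "size_of (shp (cls u)) \<le> length u"
    "size_of (shp (cls u)) = length u \<Longrightarrow> shp (cls u) = (npos u, nneg u)"
    using steps_measure[of u "word xs ys"] by (auto simp: size_of_def)
qed

text \<open>A rewriting step cannot shorten a geodesic word, so it would have to lower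
  \<open>inversions\<close>; but a word with all generators in front has none.\<close>

lemma geodesic_normal:
  assumes "set xs \<subseteq> P" "set ys \<subseteq> P" "shp (cls (word xs ys)) = (length xs, length ys)"
  shows "normal xs ys"
proof -
  have "irreducible (word xs ys)"
    unfolding irreducible_def
  proof
    assume "\<exists>v. step (word xs ys) v"
    then obtain v where v: "step (word xs ys) v" by blast
    then have "cls v = cls (word xs ys)" "v \<in> words P"
      using steps_cls[of "word xs ys" v] steps_words[of "word xs ys" v] assms by auto
    then have "length v \<ge> length xs + length ys"
      using shp_word(1)[of v] assms by (simp add: size_of_def)
    then have "inversions v < inversions (word xs ys)" using step_measure[OF v] by auto
    moreover have "inversions (map Pos as) = 0" "inversions (map Neg as) = 0" for as :: "'p list"
      by (induction as) auto
    ultimately show False by simp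
  qed
  then show ?thesis using irreducible_word_iff assms by blast
qed


section \<open>Grids of commutation squares\<close>

text \<open>\<open>row t S X y\<close> and \<open>grid ts S X ys\<close> stand for \<open>t\<^sup>-\<^sup>1 S = X y\<^sup>-\<^sup>1\<close> and \<open>ts\<^sup>-\<^sup>1 S = X ys\<^sup>-\<^sup>1\<close>,
  where each letter of \<open>ts\<close> and \<open>ys\<close> is inverted and the order of the letters is kept.\<close>

inductive row :: "'p \<Rightarrow> 'p list \<Rightarrow> 'p list \<Rightarrow> 'p \<Rightarrow> bool" where
  row_Nil: "row t [] [] t"
| row_Cons: "square t s x r \<Longrightarrow> row r S X y \<Longrightarrow> row t (s # S) (x # X) y"

inductive grid :: "'p list \<Rightarrow> 'p list \<Rightarrow> 'p list \<Rightarrow> 'p list \<Rightarrow> bool" where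
  grid_Nil: "grid [] S S []"
| grid_Cons: "grid ts S X ys \<Longrightarrow> row t X X' y \<Longrightarrow> grid (t # ts) S X' (y # ys)"

inductive_cases row_NilE: "row t [] X y"
inductive_cases row_ConsE: "row t (s # S) X y"
inductive_cases row_NilE': "row t S [] y"
inductive_cases row_ConsE': "row t S (x # X) y"
inductive_cases grid_NilE: "grid [] S X ys"
inductive_cases grid_ConsE: "grid (t # ts) S X ys"
inductive_cases grid_NilE': "grid ts S X []"
inductive_cases grid_ConsE': "grid ts S X (y # ys)"

lemma row_unique: "row t S X y \<Longrightarrow> row t S X' y' \<Longrightarrow> X = X' \<and> y = y'"
proof (induction arbitrary: X' y' rule: row.induct)
  case row_Nil
  then show ?case by (auto elim: row_NilE)
next
  case (row_Cons t s x r S X y)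
  then show ?case by (metis row_ConsE square_unique)
qed

lemma row_unique_back: "row t S X y \<Longrightarrow> row t' S' X y \<Longrightarrow> t = t' \<and> S = S'"
proof (induction arbitrary: t' S' rule: row.induct)
  case row_Nil
  then show ?case by (auto elim: row_NilE')
next
  case (row_Cons t s x r S X y)
  then show ?case by (metis row_ConsE' square_unique_back)
qed

lemma grid_unique: "grid ts S X ys \<Longrightarrow> grid ts S X' ys' \<Longrightarrow> X = X' \<and> ys = ys'"
proof (induction arbitrary: X' ys' rule: grid.induct)
  case grid_Nil
  then show ?case by (auto elim: grid_NilE)
next
  case (grid_Cons ts S X ys t X1 y)
  then show ?case by (metis grid_ConsE row_unique)
qed

lemma grid_unique_back: "grid ts S X ys \<Longrightarrow> grid ts' S' X ys \<Longrightarrow> ts = ts' \<and> S = S'"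
proof (induction arbitrary: ts' S' rule: grid.induct)
  case grid_Nil
  then show ?case by (auto elim: grid_NilE')
next
  case (grid_Cons ts S X ys t X1 y)
  then show ?case by (metis grid_ConsE' row_unique_back)
qed

section \<open>Boundaries of grids and the gluing of grids\<close>

lemma row_length: "row t S X y \<Longrightarrow> length X = length S"
  by (induction rule: row.induct) auto

lemma grid_length: "grid ts S X ys \<Longrightarrow> length X = length S \<and> length ys = length ts"
  by (induction rule: grid.induct) (auto dest: row_length)

lemma row_in_P: "row t S X y \<Longrightarrow> set S \<subseteq> P \<and> set X \<subseteq> P \<and> (t \<in> P \<longleftrightarrow> y \<in> P)"
  by (induction rule: row.induct) (auto dest: square_in_P)

lemma grid_in_P:
  "grid ts S X ys \<Longrightarrow> (set S \<subseteq> P \<longleftrightarrow> set X \<subseteq> P) \<and> (set ts \<subseteq> P \<longleftrightarrow> set ys \<subseteq> P)"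
  by (induction rule: grid.induct) (auto dest: row_in_P)

lemma row_steps: "row t S X y \<Longrightarrow> steps (Neg t # map Pos S) (map Pos X @ [Neg y])"
proof (induction rule: row.induct)
  case (row_Cons t s x r S X y)
  have "steps (Neg t # map Pos (s # S)) (Pos x # Neg r # map Pos S)"
    using rule_steps0[OF rule.swap[OF row_Cons(1)]] by simp
  also have "steps (Pos x # Neg r # map Pos S) (map Pos (x # X) @ [Neg y])"
    using steps_context[OF row_Cons.IH, of "[Pos x]" "[]"] by simp
  finally show ?case .
qed simp

lemma grid_steps: "grid ts S X ys \<Longrightarrow> steps (map Neg ts @ map Pos S) (word X ys)"
proof (induction rule: grid.induct)
  case (grid_Cons ts S X ys t X' y)
  have "steps (map Neg (t # ts) @ map Pos S) (Neg t # word X ys)"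
    using steps_context[OF grid_Cons.IH, of "[Neg t]" "[]"] by simp
  also have "steps (Neg t # word X ys) (word X' (y # ys))"
    using steps_context[OF row_steps[OF grid_Cons(2)], of "[]" "map Neg ys"] by simp
  finally show ?case .
qed simp

lemma row_nonemptyE:
  assumes "row t S X y" "S \<noteq> [] \<or> X \<noteq> []"
  obtains s S' x X' r where "S = s # S'" "X = x # X'" "square t s x r" "row r S' X' y"
  using assms(1) by cases (use assms(2) that in auto)

lemma row_append: "row t S X r \<Longrightarrow> row r S' X' y \<Longrightarrow> row t (S @ S') (X @ X') y"
  by (induction rule: row.induct) (auto intro: row.intros)

lemma grid_append_right:
  "grid ts S X ys \<Longrightarrow> grid ys S' X' ys' \<Longrightarrow> grid ts (S @ S') (X @ X') ys'"
proof (induction arbitrary: S' X' ys' rule: grid.induct)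
  case grid_Nil
  then show ?case by (auto elim: grid_NilE intro: grid.intros)
next
  case (grid_Cons ts S X ys t X1 y)
  then show ?case by (auto elim!: grid_ConsE intro!: grid.grid_Cons row_append)
qed

text \<open>The letters of \<open>ts'\<close> stand next to \<open>S\<close>, so their rows are
  filled first; \<open>X0\<close> is the path between the two blocks of rows.\<close>

lemma grid_append_split:
  "grid (ts @ ts') S X ys \<Longrightarrow>
     \<exists>X0 ys1 ys2. grid ts' S X0 ys2 \<and> grid ts X0 X ys1 \<and> ys = ys1 @ ys2"
proof (induction ts arbitrary: X ys)
  case Nil
  then show ?case by (auto intro: grid_Nil)
next
  case (Cons t ts)
  then obtain X1 y ys0 where 1: "grid (ts @ ts') S X1 ys0" "row t X1 X y" "ys = y # ys0"
    by (auto elim: grid_ConsE)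
  obtain X0 ys1 ys2 where "grid ts' S X0 ys2" "grid ts X0 X1 ys1" "ys0 = ys1 @ ys2"
    using Cons.IH[OF 1(1)] by blast
  then have "grid ts' S X0 ys2 \<and> grid (t # ts) X0 X (y # ys1) \<and> ys = (y # ys1) @ ys2"
    using 1 grid_Cons by auto
  then show ?case by blast
qed

text \<open>The last letter of \<open>ts\<close> and the first of \<open>S\<close> bound the first
  square to be filled, and the lower letters of a square are distinct.\<close>

lemma grid_corner: "grid ts S X ys \<Longrightarrow> ts \<noteq> [] \<Longrightarrow> S \<noteq> [] \<Longrightarrow> last ts \<noteq> hd S"
proof (induction rule: grid.induct)
  case (grid_Cons ts S X ys t X' y)
  show ?case
  proof (cases "ts = []")
    case True
    then have "X = S" using grid_Cons(1) by (auto elim: grid_NilE)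
    then obtain s S' x r where "S = s # S'" "square t s x r"
      using grid_Cons row_nonemptyE by metis
    then show ?thesis using True square_neq by auto
  next
    case False
    then show ?thesis using grid_Cons by simp
  qed
qed simp

section \<open>Filling a grid, or else shortening the word\<close>

lemma row_or_shorter:
  "t \<in> P \<Longrightarrow> set S \<subseteq> P \<Longrightarrow> (\<exists>X y. row t S X y) \<or>
     (\<exists>v. steps (Neg t # map Pos S) v \<and> length v < Suc (length S))"
proof (induction S arbitrary: t)
  case Nil
  then show ?case using row_Nil by blast
next
  case (Cons s S)
  show ?case
  \<comment> \<open>The only obstruction to a square is \<open>t = s\<close>, and then the two
    letters cancel. Over a geodesic word the row can therefore always be filled.\<close>
  proof (cases "t = s")
    case True
    then have "steps (Neg t # map Pos (s # S)) (map Pos S)"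
      using rule_steps0[OF rule.NP, of t] Cons by simp
    moreover have "length (map Pos S) < Suc (length (s # S))" by simp
    ultimately show ?thesis by blast
  next
    case False
    then obtain x r where sq: "square t s x r" using square_exists[of t s] Cons.prems by auto
    then have "r \<in> P" using square_in_P by blast
    have st: "steps (Neg t # map Pos (s # S)) (Pos x # Neg r # map Pos S)"
      using rule_steps0[OF rule.swap[OF sq]] by simp
    from Cons.IH[OF \<open>r \<in> P\<close>] Cons.prems
    consider X y where "row r S X y" | v where "steps (Neg r # map Pos S) v" "length v < Suc (length S)"
      by auto
    then show ?thesis
    proof cases
      case 1
      then show ?thesis using row_Cons sq by blast
    next
      case 2
      then have "steps (Neg t # map Pos (s # S)) (Pos x # v)"
        using st steps_context[OF 2(1), of "[Pos x]" "[]"] by (auto intro: rtranclp_trans)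
      moreover have "length (Pos x # v) < Suc (length (s # S))" using 2 by simp
      ultimately show ?thesis by blast
    qed
  qed
qed

lemma grid_or_shorter:
  "set ts \<subseteq> P \<Longrightarrow> set S \<subseteq> P \<Longrightarrow> (\<exists>X ys. grid ts S X ys) \<or>
     (\<exists>v. steps (map Neg ts @ map Pos S) v \<and> length v < length ts + length S)"
proof (induction ts)
  case Nil
  then show ?case using grid_Nil by blast
next
  case (Cons t ts)
  then consider X ys where "grid ts S X ys"
    | v where "steps (map Neg ts @ map Pos S) v" "length v < length ts + length S"
    by auto
  then show ?case
  proof cases
    case 1
    then have st: "steps (map Neg (t # ts) @ map Pos S) ((Neg t # map Pos X) @ map Neg ys)"
      using steps_context[OF grid_steps[OF 1], of "[Neg t]" "[]"] by simp
    have "set X \<subseteq> P" "length X = length S" "length ys = length ts"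
      using grid_in_P[OF 1] grid_length[OF 1] Cons.prems by auto
    from row_or_shorter[of t X] Cons.prems this(1)
    consider X' y where "row t X X' y"
      | v where "steps (Neg t # map Pos X) v" "length v < Suc (length X)"
      by auto
    then show ?thesis
    proof cases
      fix X' y assume "row t X X' y"
      then show ?thesis using grid_Cons 1 by blast
    next
      fix v assume v: "steps (Neg t # map Pos X) v" "length v < Suc (length X)"
      have "steps (map Neg (t # ts) @ map Pos S) (v @ map Neg ys)"
        using st steps_context[OF v(1), of "[]" "map Neg ys"] by simp
      moreover have "length (v @ map Neg ys) < length (t # ts) + length S"
        using v \<open>length X = length S\<close> \<open>length ys = length ts\<close> by simp
      ultimately show ?thesis by blast
    qed
  next
    case 2
    then have "steps (map Neg (t # ts) @ map Pos S) (Neg t # v)"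
      using steps_context[OF 2(1), of "[Neg t]" "[]"] by simp
    moreover have "length (Neg t # v) < length (t # ts) + length S" using 2 by simp
    ultimately show ?thesis by blast
  qed
qed

text \<open>Here squares are filled against the direction of \<open>swap\<close>, so the shorter
  word is only reached up to \<open>group_eq\<close>, not by \<open>steps\<close>.\<close>

lemma row_back_or_shorter:
  "set X \<subseteq> P \<Longrightarrow> y \<in> P \<Longrightarrow> (\<exists>t S. row t S X y) \<or>
     (\<exists>v. group_eq (map Pos X @ [Neg y]) v \<and> length v < Suc (length X))"
proof (induction X)
  case Nil
  then show ?case using row_Nil by blast
next
  case (Cons x X)
  then consider r S where "row r S X y"
    | v where "group_eq (map Pos X @ [Neg y]) v" "length v < Suc (length X)"
    by auto
  then show ?case
  proof cases
    case 1
    then have P: "r \<in> P" "set S \<subseteq> P" "length X = length S"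
      using row_in_P[OF 1] row_length[OF 1] Cons.prems by auto
    show ?thesis
    \<comment> \<open>The row already found turns the tail into \<open>r^-1 S\<close>. A square
      ending in \<open>x r^-1\<close> needs \<open>x \<noteq> r\<close>; otherwise these two letters
      cancel and \<open>S\<close> alone remains.\<close>
    proof (cases "x = r")
      case True
      have "group_eq (Neg r # map Pos S) (map Pos X @ [Neg y])"
        using row_steps[OF 1] P by (intro steps_group_eq) auto
      then have "group_eq ([Pos x] @ (Neg r # map Pos S) @ []) ([Pos x] @ (map Pos X @ [Neg y]) @ [])"
        using Cons.prems by (intro group_eq_context) auto
      moreover have "group_eq ([] @ [Pos r, Neg r] @ map Pos S) ([] @ [] @ map Pos S)"
        using P by (intro group_eq_context pres_eq.pos_neg) auto
      ultimately have "group_eq (map Pos (x # X) @ [Neg y]) (map Pos S)"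
        using True pres_eq.sym pres_eq.trans by fastforce
      moreover have "length (map Pos S) < Suc (length (x # X))" using P by simp
      ultimately show ?thesis by blast
    next
      case False
      then show ?thesis using square_exists_back[of x r] row_Cons 1 P Cons.prems by (metis list.set_intros(1) subsetD)
    qed
  next
    case 2
    then have "group_eq ([Pos x] @ (map Pos X @ [Neg y]) @ []) ([Pos x] @ v @ [])"
      using Cons.prems by (intro group_eq_context) auto
    moreover have "length ([Pos x] @ v @ []) < Suc (length (x # X))" using 2 by simp
    ultimately show ?thesis by (metis append_Cons append_Nil append_Nil2 list.map(2))
  qed
qed

lemma grid_back_or_shorter:
  "set X \<subseteq> P \<Longrightarrow> set ys \<subseteq> P \<Longrightarrow> (\<exists>ts S. grid ts S X ys) \<or>
     (\<exists>v. group_eq (word X ys) v \<and> length v < length X + length ys)"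
proof (induction ys arbitrary: X)
  case Nil
  then show ?case using grid_Nil by blast
next
  case (Cons y ys)
  then consider t X0 where "row t X0 X y"
    | v where "group_eq (map Pos X @ [Neg y]) v" "length v < Suc (length X)"
    using row_back_or_shorter[of X y] by auto
  then show ?case
  proof cases
    case 1
    then have P: "t \<in> P" "set X0 \<subseteq> P" "length X0 = length X" "set ys \<subseteq> P"
      using row_in_P[OF 1] row_length[OF 1] Cons.prems by auto
    consider ts S where "grid ts S X0 ys"
      | v where "group_eq (word X0 ys) v" "length v < length X0 + length ys"
      using Cons.IH P by blast
    then show ?thesis
    proof cases
      fix ts S assume "grid ts S X0 ys"
      then show ?thesis using grid_Cons 1 by blast
    next
      fix v assume v: "group_eq (word X0 ys) v" "length v < length X0 + length ys"
      have "group_eq (Neg t # map Pos X0) (map Pos X @ [Neg y])"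
        using row_steps[OF 1] P by (intro steps_group_eq) auto
      then have "group_eq ([] @ (Neg t # map Pos X0) @ map Neg ys) ([] @ (map Pos X @ [Neg y]) @ map Neg ys)"
        using P by (intro group_eq_context) auto
      moreover have "group_eq ([Neg t] @ word X0 ys @ []) ([Neg t] @ v @ [])"
        using P v by (intro group_eq_context) auto
      ultimately have "group_eq (word X (y # ys)) (Neg t # v)"
        using pres_eq.sym pres_eq.trans by fastforce
      moreover have "length (Neg t # v) < length X + length (y # ys)" using P v by simp
      ultimately show ?thesis by blast
    qed
  next
    case 2
    then have "group_eq ([] @ (map Pos X @ [Neg y]) @ map Neg ys) ([] @ v @ map Neg ys)"
      using Cons.prems by (intro group_eq_context) auto
    then have "group_eq (word X (y # ys)) (v @ map Neg ys)" by simp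
    moreover have "length (v @ map Neg ys) < length X + length (y # ys)" using 2 by simp
    ultimately show ?thesis by blast
  qed
qed

section \<open>Normality propagates through squares, rows and grids\<close>

lemma square_right_neq: "square t s x r \<Longrightarrow> \<not> J s y \<Longrightarrow> r \<noteq> y"
  unfolding square_def J_def by (blast dest: T_cycle)

text \<open>If \<open>J x x'\<close>, then the lines of \<open>x\<close> and \<open>r\<close> share
  both the apex \<open>w\<close> and the point \<open>x'\<close>, so \<open>w = x'\<close>. The
  second apex \<open>v\<close> is then \<open>s\<close>, which contradicts
  \<open>\<not> J s y\<close>.\<close>

lemma square_right_not_J:
  assumes "square t s x r" "square r y x' r'" "\<not> J s y"
  shows "\<not> J x x'"
proof
  assume "J x x'"
  then obtain z where z: "(x, x', z) \<in> T" unfolding J_def by blast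
  obtain w v where T: "(w, t, x) \<in> T" "(w, s, r) \<in> T" "(v, r, x') \<in> T" "(v, y, r') \<in> T"
    using assms(1,2) unfolding square_def by blast
  then have *: "(x, w, t) \<in> T" "(r, w, s) \<in> T" "(r, x', v) \<in> T"
    using T_cycle T_cycle' by blast+
  have "x \<noteq> r" using assms square_neq by blast
  then have "w = x'" using meet_unique[OF *(1,2) z *(3)] by blast
  then have "s = v" using * T_unique by blast
  then show False using T assms(3) unfolding J_def by blast
qed

lemma square_up_neq: "square t s x r \<Longrightarrow> \<not> J t t' \<Longrightarrow> t' \<noteq> x"
  unfolding square_def J_def by (blast dest: T_cycle)

text \<open>The same argument for two squares stacked vertically: \<open>J r r'\<close> would force
  \<open>w = r'\<close>, hence \<open>v = t\<close> and \<open>J t t'\<close>.\<close>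

lemma square_up_not_J:
  assumes "square t s x r" "square t' x x' r'" "\<not> J t t'"
  shows "\<not> J r r'"
proof
  assume "J r r'"
  then obtain z where z: "(r, r', z) \<in> T" unfolding J_def by blast
  obtain w v where T: "(w, t, x) \<in> T" "(w, s, r) \<in> T" "(v, t', x') \<in> T" "(v, x, r') \<in> T"
    using assms(1,2) unfolding square_def by blast
  then have *: "(x, w, t) \<in> T" "(r, w, s) \<in> T" "(x, r', v) \<in> T"
    using T_cycle T_cycle' by blast+
  have "x \<noteq> r" using assms square_neq by blast
  then have "w = r'" using meet_unique[OF *(1,2,3) z] by blast
  then have "t = v" using * T_unique by blast
  then show False using T assms(3) unfolding J_def by blast
qed

text \<open>Nothing can cancel along a row over a reduced \<open>S\<close>: by
  \<open>square_right_neq\<close> the letter leaving one square differs from the next letter of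
  \<open>S\<close>, so the next square exists.\<close>

lemma row_total:
  "successively (\<lambda>x y. \<not> J x y) S \<Longrightarrow> t \<in> P \<Longrightarrow> set S \<subseteq> P \<Longrightarrow> (S \<noteq> [] \<Longrightarrow> t \<noteq> hd S) \<Longrightarrow>
     \<exists>X y. row t S X y \<and> successively (\<lambda>x y. \<not> J x y) X \<and> (X \<noteq> [] \<longrightarrow> last X \<noteq> y)"
proof (induction S arbitrary: t)
  case Nil
  show ?case by (rule exI[of _ "[]"]) (auto intro: row_Nil)
next
  case (Cons s S)
  then obtain x r where sq: "square t s x r" using square_exists[of t s] by auto
  have "\<exists>X y. row r S X y \<and> successively (\<lambda>x y. \<not> J x y) X \<and> (X \<noteq> [] \<longrightarrow> last X \<noteq> y)"
  proof (rule Cons.IH)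
    show "r \<noteq> hd S" if "S \<noteq> []"
      using square_right_neq[OF sq] Cons.prems(1) that by (auto simp: successively_Cons)
  qed (use Cons.prems square_in_P[OF sq] in \<open>auto simp: successively_Cons\<close>)
  then obtain X y where X: "row r S X y" "successively (\<lambda>x y. \<not> J x y) X" "X \<noteq> [] \<longrightarrow> last X \<noteq> y"
    by blast
  have "\<not> J x (hd X)" if "X \<noteq> []"
  proof -
    from X(1) that obtain s' S' x' X' r' where "S = s' # S'" "X = x' # X'" "square r s' x' r'"
      using row_nonemptyE by metis
    then show ?thesis using square_right_not_J[OF sq] Cons.prems(1) by auto
  qed
  then have "successively (\<lambda>x y. \<not> J x y) (x # X)" using X(2) by (auto simp: successively_Cons)
  \<comment> \<open>If \<open>X\<close> is empty, the row is a single square with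
    \<open>y = r\<close>, and \<open>square_neq\<close> gives \<open>x \<noteq> r\<close>.\<close>
  moreover have "last (x # X) \<noteq> y"
    using X(1,3) square_neq[OF sq] by (cases "X = []") (auto elim: row_NilE')
  ultimately show ?case using row_Cons[OF sq X(1)] by blast
qed

lemma rows_not_J: "row t S X y \<Longrightarrow> row t' X X' y' \<Longrightarrow> \<not> J t t' \<Longrightarrow> \<not> J y y'"
proof (induction arbitrary: t' X' rule: row.induct)
  case (row_Nil t)
  then show ?case by (auto elim: row_NilE)
next
  case (row_Cons t s x r S X y)
  then show ?case by (metis row_ConsE square_up_not_J)
qed

lemma row_up_neq: "row t S X y \<Longrightarrow> X \<noteq> [] \<Longrightarrow> \<not> J t t' \<Longrightarrow> t' \<noteq> hd X"
  by (erule row_nonemptyE) (auto dest: square_up_neq)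

text \<open>Rows are filled starting from the last letter of \<open>ts\<close>. The next letter
  \<open>t\<close> differs from the head of the row below by the corner hypothesis for the first
  row, and by \<open>row_up_neq\<close> afterwards; \<open>rows_not_J\<close> keeps
  \<open>ys\<close> reduced.\<close>

lemma grid_total:
  assumes "successively (\<lambda>x y. \<not> J y x) ts" "successively (\<lambda>x y. \<not> J x y) S"
    "set ts \<subseteq> P" "set S \<subseteq> P" "ts \<noteq> [] \<Longrightarrow> S \<noteq> [] \<Longrightarrow> last ts \<noteq> hd S"
  shows "\<exists>X ys. grid ts S X ys \<and> successively (\<lambda>x y. \<not> J x y) X \<and> successively (\<lambda>x y. \<not> J y x) ys \<and>
           (ts \<noteq> [] \<longrightarrow> X \<noteq> [] \<longrightarrow> last X \<noteq> hd ys)"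
  using assms
proof (induction ts)
  case Nil
  then show ?case using grid_Nil by force
next
  case (Cons t ts)
  then obtain X ys where X: "grid ts S X ys" "successively (\<lambda>x y. \<not> J x y) X"
      "successively (\<lambda>x y. \<not> J y x) ys"
    by (force simp: successively_Cons)
  have tX: "t \<noteq> hd X" if "X \<noteq> []"
  proof (cases ts)
    case Nil
    then have "X = S" using X by (auto elim: grid_NilE)
    then show ?thesis using Cons.prems Nil that by auto
  next
    case (Cons t1 ts1)
    then obtain X0 y0 where "row t1 X0 X y0" using X(1) by (auto elim: grid_ConsE)
    then show ?thesis using Cons.prems(1) row_up_neq that Cons by fastforce
  qed
  have "set X \<subseteq> P" using grid_in_P[OF X(1)] Cons.prems by simp
  then obtain X' y where X': "row t X X' y" "successively (\<lambda>x y. \<not> J x y) X'"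
      "X' \<noteq> [] \<longrightarrow> last X' \<noteq> y"
    using row_total[OF X(2), of t] tX Cons.prems by auto
  have "successively (\<lambda>x y. \<not> J y x) (y # ys)"
  proof (cases ts)
    case Nil
    then show ?thesis using X by (auto elim: grid_NilE)
  next
    case (Cons t1 ts1)
    then show ?thesis using X(1,3) X'(1) Cons.prems(1) rows_not_J
      by (auto elim!: grid_ConsE)
  qed
  then show ?case using grid_Cons[OF X(1) X'(1)] X' by force
qed


section \<open>Factorisation and gluing\<close>

abbreviation "G \<equiv> tri_group P T"

lemma group_G: "group G"
  unfolding tri_group_def by (rule group_presented_group)

lemma carrier_G: "carrier G = cls ` words P"
  by (simp add: tri_group_def presented_group_def cls_def)

lemma cls_in_carrier [simp]: "u \<in> words P \<Longrightarrow> cls u \<in> carrier G"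
  by (simp add: carrier_G)

lemma mult_cls: "u \<in> words P \<Longrightarrow> v \<in> words P \<Longrightarrow> cls u \<otimes>\<^bsub>G\<^esub> cls v = cls (u @ v)"
  by (simp add: tri_group_def cls_def pres_class_mult)

lemma one_G: "\<one>\<^bsub>G\<^esub> = cls []"
  by (simp add: tri_group_def presented_group_def cls_def)

lemma carrier_obtain_normal:
  assumes "w \<in> carrier G"
  obtains xs ys where "normal xs ys" "w = cls (word xs ys)" "shp w = (length xs, length ys)"
proof -
  obtain u where u: "w = cls u" "u \<in> words P" using assms carrier_G by blast
  then show thesis using normal_form_exists[OF u(2)] that by metis
qed

lemma shp_one: "shp \<one>\<^bsub>G\<^esub> = 0"
  using shp_normal[of "[]" "[]"] by (simp add: one_G normal_def zero_prod_def)

lemma normal_in_P: "normal xs ys \<Longrightarrow> set xs \<subseteq> P" "normal xs ys \<Longrightarrow> set ys \<subseteq> P"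
  by (auto simp: normal_def)

lemma shp_mult:
  assumes "h \<in> carrier G" "k \<in> carrier G"
  shows "size_of (shp (h \<otimes>\<^bsub>G\<^esub> k)) \<le> size_of (shp h) + size_of (shp k)"
    and "size_of (shp (h \<otimes>\<^bsub>G\<^esub> k)) = size_of (shp h) + size_of (shp k) \<Longrightarrow>
           shp (h \<otimes>\<^bsub>G\<^esub> k) = shp h + shp k"
proof -
  obtain xs ys where h: "normal xs ys" "h = cls (word xs ys)" "shp h = (length xs, length ys)"
    using carrier_obtain_normal assms by metis
  obtain xs' ys' where k: "normal xs' ys'" "k = cls (word xs' ys')" "shp k = (length xs', length ys')"
    using carrier_obtain_normal assms by metis
  let ?w = "word xs ys @ word xs' ys'"
  have hk: "h \<otimes>\<^bsub>G\<^esub> k = cls ?w" "?w \<in> words P"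
    using h k normal_in_P[OF h(1)] normal_in_P[OF k(1)] mult_cls[of "word xs ys" "word xs' ys'"]
    by simp_all
  show "size_of (shp (h \<otimes>\<^bsub>G\<^esub> k)) \<le> size_of (shp h) + size_of (shp k)"
    using shp_word(1)[OF hk(2)] h(3) k(3) hk(1) by (simp add: size_of_def)
  show "shp (h \<otimes>\<^bsub>G\<^esub> k) = shp h + shp k"
    if "size_of (shp (h \<otimes>\<^bsub>G\<^esub> k)) = size_of (shp h) + size_of (shp k)"
    using shp_word(2)[OF hk(2)] h(3) k(3) hk(1) that by (simp add: size_of_def)
qed

text \<open>Cut the normal form as \<open>X1 X2 Y1^-1 Y2^-1\<close> and fill a grid backwards to
  turn \<open>X2 Y1^-1\<close> into \<open>ts^-1 S\<close>. The grid exists because normal forms are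
  geodesic, and the factors are \<open>X1 ts^-1\<close> and \<open>S Y2^-1\<close>.\<close>

lemma factorisation_exists:
  assumes "w \<in> carrier G" "shp w = m + n"
  shows "\<exists>h\<in>carrier G. \<exists>k\<in>carrier G. w = h \<otimes>\<^bsub>G\<^esub> k \<and> shp h = m \<and> shp k = n"
proof -
  obtain xs ys where w: "normal xs ys" "w = cls (word xs ys)" "shp w = (length xs, length ys)"
    using carrier_obtain_normal assms by metis
  obtain m1 m2 n1 n2 where mn: "m = (m1, m2)" "n = (n1, n2)" by (cases m; cases n)
  define X1 X2 Y1 Y2 where defs: "X1 = take m1 xs" "X2 = drop m1 xs" "Y1 = take m2 ys" "Y2 = drop m2 ys"
  have len: "length X1 = m1" "length X2 = n1" "length Y1 = m2" "length Y2 = n2"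
    using w(3) assms(2) mn by (auto simp: defs)
  have xy: "xs = X1 @ X2" "ys = Y1 @ Y2" by (simp_all add: defs)
  then have P: "set X1 \<subseteq> P" "set X2 \<subseteq> P" "set Y1 \<subseteq> P" "set Y2 \<subseteq> P"
    using normal_in_P[OF w(1)] by auto
  have "\<exists>ts S. grid ts S X2 Y1"
  proof (rule ccontr)
    assume "\<nexists>ts S. grid ts S X2 Y1"
    then obtain v where v: "group_eq (word X2 Y1) v" "length v < length X2 + length Y1"
      using grid_back_or_shorter[OF P(2,3)] by blast
    have "group_eq (map Pos X1 @ word X2 Y1 @ map Neg Y2) (map Pos X1 @ v @ map Neg Y2)"
      using P v by (intro group_eq_context) auto
    then have "w = cls (map Pos X1 @ v @ map Neg Y2)"
      using w(2) P by (simp add: cls_eq_iff xy)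
    moreover have "map Pos X1 @ v @ map Neg Y2 \<in> words P"
      using pres_eq_words[OF v(1)] P by simp
    ultimately have "size_of (shp w) \<le> length (map Pos X1 @ v @ map Neg Y2)"
      using shp_word(1) by blast
    then show False using v(2) w(3) xy by (simp add: size_of_def)
  qed
  then obtain ts S where g: "grid ts S X2 Y1" by blast
  have P': "set ts \<subseteq> P" "set S \<subseteq> P" using grid_in_P[OF g] P by auto
  have len': "length ts = m2" "length S = n1" using grid_length[OF g] len by auto
  let ?h = "cls (word X1 ts)" and ?k = "cls (word S Y2)"
  have "cls (map Pos X1 @ (map Neg ts @ map Pos S) @ map Neg Y2) = cls (map Pos X1 @ word X2 Y1 @ map Neg Y2)"
    using P P' by (intro steps_cls steps_context grid_steps g) auto
  then have hk: "?h \<otimes>\<^bsub>G\<^esub> ?k = w"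
    using P P' mult_cls[of "word X1 ts" "word S Y2"] by (simp add: w(2) xy)
  have hkc: "?h \<in> carrier G" "?k \<in> carrier G" using P P' by simp_all
  \<comment> \<open>Each factor is at most as long as its word, and these bounds add up to the
    length of \<open>w\<close>. Both words are thus geodesic, and their letter counts are the
    shapes.\<close>
  have le: "size_of (shp ?h) \<le> m1 + m2" "size_of (shp ?k) \<le> n1 + n2"
    using shp_word(1)[of "word X1 ts"] shp_word(1)[of "word S Y2"] P P' len len' by auto
  have "size_of (shp w) = m1 + m2 + (n1 + n2)"
    using assms(2) mn by (simp add: size_of_def)
  then have "size_of (shp ?h) = m1 + m2" "size_of (shp ?k) = n1 + n2"
    using shp_mult(1)[OF hkc] hk le by auto
  then have "shp ?h = m" "shp ?k = n"
    using shp_word(2)[of "word X1 ts"] shp_word(2)[of "word S Y2"] P P' len len' mn by auto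
  then show ?thesis using hk hkc by blast
qed

text \<open>If the product of two normal forms is geodesic, then the inner factors \<open>Y\<^sub>1\<^sup>-\<^sup>1 X\<^sub>2\<close>
  commute past each other without cancellation.\<close>

lemma mult_normal:
  assumes h: "normal X1 Y1" and k: "normal X2 Y2"
    and add: "shp (cls (word X1 Y1) \<otimes>\<^bsub>G\<^esub> cls (word X2 Y2)) = shp (cls (word X1 Y1)) + shp (cls (word X2 Y2))"
  obtains X Y where "grid Y1 X2 X Y" "normal (X1 @ X) (Y @ Y2)"
    "cls (word X1 Y1) \<otimes>\<^bsub>G\<^esub> cls (word X2 Y2) = cls (word (X1 @ X) (Y @ Y2))"
proof -
  have P: "set X1 \<subseteq> P" "set X2 \<subseteq> P" "set Y1 \<subseteq> P" "set Y2 \<subseteq> P"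
    using normal_in_P[OF h] normal_in_P[OF k] by auto
  let ?w = "cls (word X1 Y1) \<otimes>\<^bsub>G\<^esub> cls (word X2 Y2)"
  have w: "?w = cls (map Pos X1 @ (map Neg Y1 @ map Pos X2) @ map Neg Y2)"
    using P mult_cls[of "word X1 Y1" "word X2 Y2"] by simp
  have shp: "shp ?w = (length X1 + length X2, length Y1 + length Y2)"
    using add shp_normal[OF h] shp_normal[OF k] by simp
  have "\<exists>X Y. grid Y1 X2 X Y"
  proof (rule ccontr)
    assume "\<nexists>X Y. grid Y1 X2 X Y"
    then obtain v where v: "steps (map Neg Y1 @ map Pos X2) v" "length v < length Y1 + length X2"
      using grid_or_shorter[OF P(3,2)] by blast
    have "v \<in> words P" using steps_words[OF v(1)] P by simp
    have "?w = cls (map Pos X1 @ v @ map Neg Y2)"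
      unfolding w using P v by (intro steps_cls steps_context) auto
    moreover have "map Pos X1 @ v @ map Neg Y2 \<in> words P"
      using \<open>v \<in> words P\<close> P by simp
    ultimately have "size_of (shp ?w) \<le> length (map Pos X1 @ v @ map Neg Y2)"
      using shp_word(1) by metis
    then show False using v(2) shp by (simp add: size_of_def)
  qed
  then obtain X Y where g: "grid Y1 X2 X Y" by blast
  have P': "set X \<subseteq> P" "set Y \<subseteq> P" using grid_in_P[OF g] P by auto
  have "?w = cls (map Pos X1 @ word X Y @ map Neg Y2)"
    unfolding w using P by (intro steps_cls steps_context grid_steps g) auto
  then have eq: "?w = cls (word (X1 @ X) (Y @ Y2))" by simp
  have "normal (X1 @ X) (Y @ Y2)"
  proof (rule geodesic_normal)
    show "shp (cls (word (X1 @ X) (Y @ Y2))) = (length (X1 @ X), length (Y @ Y2))"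
      using shp grid_length[OF g] unfolding eq by simp
  qed (use P P' in auto)
  then show thesis using that g eq by blast
qed

text \<open>By \<open>mult_normal\<close> both products have explicit normal forms, whose pieces
  agree because their lengths do. The outer boundary \<open>X\<close>, \<open>Y\<close> of the grid
  then determines the inner one, \<open>Y1\<close> and \<open>X2\<close>.\<close>

lemma factorisation_unique:
  assumes c: "h \<in> carrier G" "k \<in> carrier G" "h' \<in> carrier G" "k' \<in> carrier G"
    and eq: "h \<otimes>\<^bsub>G\<^esub> k = h' \<otimes>\<^bsub>G\<^esub> k'"
    and s: "shp h = shp h'" "shp k = shp k'" "shp (h \<otimes>\<^bsub>G\<^esub> k) = shp h + shp k"
  shows "h = h' \<and> k = k'"
proof -
  obtain X1 Y1 where h: "normal X1 Y1" "h = cls (word X1 Y1)" "shp h = (length X1, length Y1)"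
    using carrier_obtain_normal c by metis
  obtain X2 Y2 where k: "normal X2 Y2" "k = cls (word X2 Y2)" "shp k = (length X2, length Y2)"
    using carrier_obtain_normal c by metis
  obtain X1' Y1' where h': "normal X1' Y1'" "h' = cls (word X1' Y1')" "shp h' = (length X1', length Y1')"
    using carrier_obtain_normal c by metis
  obtain X2' Y2' where k': "normal X2' Y2'" "k' = cls (word X2' Y2')" "shp k' = (length X2', length Y2')"
    using carrier_obtain_normal c by metis
  obtain X Y where 1: "grid Y1 X2 X Y" "normal (X1 @ X) (Y @ Y2)" "h \<otimes>\<^bsub>G\<^esub> k = cls (word (X1 @ X) (Y @ Y2))"
    using mult_normal[OF h(1) k(1)] s(3) h(2) k(2) by metis
  obtain X' Y' where 2: "grid Y1' X2' X' Y'" "normal (X1' @ X') (Y' @ Y2')"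
      "h' \<otimes>\<^bsub>G\<^esub> k' = cls (word (X1' @ X') (Y' @ Y2'))"
    using mult_normal[OF h'(1) k'(1)] s eq h'(2) k'(2) by metis
  have "X1 @ X = X1' @ X' \<and> Y @ Y2 = Y' @ Y2'"
    using normal_unique[OF _ 1(2) 2(2)] 1(3) 2(3) eq by simp
  then have "X1 = X1'" "X = X'" "Y = Y'" "Y2 = Y2'"
    using h(3) k(3) h'(3) k'(3) s(1,2) by auto
  then have "Y1 = Y1'" "X2 = X2'"
    using grid_unique_back 1(1) 2(1) by blast+
  then show ?thesis
    using h h' k k' \<open>X1 = X1'\<close> \<open>Y2 = Y2'\<close> by simp
qed

lemma factorisation_ex1:
  assumes "w \<in> carrier G" "shp w = m + n"
  shows "\<exists>!(h, k). h \<in> carrier G \<and> k \<in> carrier G \<and> w = h \<otimes>\<^bsub>G\<^esub> k \<and> shp h = m \<and> shp k = n"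
proof -
  obtain h k where hk: "h \<in> carrier G" "k \<in> carrier G" "w = h \<otimes>\<^bsub>G\<^esub> k" "shp h = m" "shp k = n"
    using factorisation_exists[OF assms] by blast
  show ?thesis
  proof (rule ex1I[of _ "(h, k)"], goal_cases)
    case 1
    then show ?case using hk by simp
  next
    case (2 p)
    then show ?case using factorisation_unique[of h k "fst p" "snd p"] hk assms(2)
      by (auto simp: case_prod_beta)
  qed
qed

text \<open>The grids of \<open>c u\<close> and \<open>u b\<close> share the square of \<open>u\<close>; \<open>grid_total\<close> fills the remaining
  corner.\<close>

lemma shp_glue:
  assumes c: "c \<in> carrier G" "u \<in> carrier G" "b \<in> carrier G"
    and s: "shp u = (1, 1)" "shp (c \<otimes>\<^bsub>G\<^esub> u) = shp c + shp u" "shp (u \<otimes>\<^bsub>G\<^esub> b) = shp u + shp b"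
  shows "shp (c \<otimes>\<^bsub>G\<^esub> u \<otimes>\<^bsub>G\<^esub> b) = shp c + shp u + shp b"
proof -
  interpret group G by (rule group_G)
  obtain C D where C: "normal C D" "c = cls (word C D)" "shp c = (length C, length D)"
    using carrier_obtain_normal c by metis
  obtain A B where B: "normal A B" "b = cls (word A B)" "shp b = (length A, length B)"
    using carrier_obtain_normal c by metis
  obtain xs ys where xy: "normal xs ys" "u = cls (word xs ys)" "shp u = (length xs, length ys)"
    using carrier_obtain_normal c by metis
  then obtain x y where "xs = [x]" "ys = [y]"
    using s(1) by (auto simp: length_Suc_conv)
  then have u: "normal [x] [y]" "u = cls (word [x] [y])" using xy by auto
  obtain X' D' where 1: "grid D [x] X' D'" "normal (C @ X') (D' @ [y])"
      "c \<otimes>\<^bsub>G\<^esub> u = cls (word (C @ X') (D' @ [y]))"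
    using mult_normal[OF C(1) u(1)] s(2) C(2) u(2) by metis
  obtain x' where X': "X' = [x']" using grid_length[OF 1(1)] by (auto simp: length_Suc_conv)
  obtain A' Y' where 2: "grid [y] A A' Y'" "normal ([x] @ A') (Y' @ B)"
      "u \<otimes>\<^bsub>G\<^esub> b = cls (word ([x] @ A') (Y' @ B))"
    using mult_normal[OF u(1) B(1)] s(3) B(2) u(2) by metis
  obtain y' where Y': "Y' = [y']" using grid_length[OF 2(1)] by (auto simp: length_Suc_conv)
  note succ = successively_append_iff successively_Cons
  \<comment> \<open>\<open>D' @ [y]\<close> is the inverse part of the normal form of
    \<open>c u\<close>, so it is reduced. Splitting off the row of \<open>y\<close> recovers the
    grid of \<open>u b\<close> and leaves the missing corner \<open>g\<close>.\<close>
  obtain X D'' where 3: "grid (D' @ [y]) A X D''" "successively (\<lambda>x y. \<not> J y x) D''"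
  proof -
    have "\<exists>X ys. grid (D' @ [y]) A X ys \<and> successively (\<lambda>x y. \<not> J x y) X \<and>
            successively (\<lambda>x y. \<not> J y x) ys \<and> (D' @ [y] \<noteq> [] \<longrightarrow> X \<noteq> [] \<longrightarrow> last X \<noteq> hd ys)"
    proof (rule grid_total)
      show "last (D' @ [y]) \<noteq> hd A" if "A \<noteq> []"
        using grid_corner[OF 2(1) _ that] by simp
    qed (use 1(2) B(1) in \<open>auto simp: normal_def\<close>)
    then show thesis using that by blast
  qed
  obtain A0 E E' where "grid [y] A A0 E'" and g: "grid D' A0 X E" and D'': "D'' = E @ E'"
    using grid_append_split[OF 3(1)] by blast
  then have "A0 = A'" "E' = [y']" using grid_unique[OF 2(1)] Y' by auto
  then have full: "grid D (x # A') (x' # X) E"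
    using grid_append_right[OF 1(1)[unfolded X'] g] by simp
  have P: "set C \<subseteq> P" "set D \<subseteq> P" "set B \<subseteq> P" "set (x # A') \<subseteq> P"
    using C(1) B(1) 2(2) by (auto simp: normal_def)
  \<comment> \<open>The grid \<open>full\<close> is obtained a second time from
    \<open>grid_total\<close>; uniqueness of grids transfers the normality of its upper boundary to
    \<open>x' # X\<close> and \<open>E\<close>.\<close>
  obtain X1 ys1 where "grid D (x # A') X1 ys1 \<and> successively (\<lambda>x y. \<not> J x y) X1 \<and>
      successively (\<lambda>x y. \<not> J y x) ys1 \<and> (D \<noteq> [] \<longrightarrow> X1 \<noteq> [] \<longrightarrow> last X1 \<noteq> hd ys1)"
  proof -
    have "\<exists>X ys. grid D (x # A') X ys \<and> successively (\<lambda>x y. \<not> J x y) X \<and>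
            successively (\<lambda>x y. \<not> J y x) ys \<and> (D \<noteq> [] \<longrightarrow> X \<noteq> [] \<longrightarrow> last X \<noteq> hd ys)"
    proof (rule grid_total)
      show "last D \<noteq> hd (x # A')" if "D \<noteq> []"
        using grid_corner[OF 1(1) that] by simp
    qed (use C(1) 2(2) P in \<open>auto simp: normal_def\<close>)
    then show thesis using that by blast
  qed
  then have X: "successively (\<lambda>x y. \<not> J x y) (x' # X)" "D \<noteq> [] \<Longrightarrow> last (x' # X) \<noteq> hd E"
    using grid_unique[OF full, of X1 ys1] by auto
  have P': "set (x' # X) \<subseteq> P" "set E \<subseteq> P" "y' \<in> P"
    using grid_in_P[OF full] P 2(2) Y' by (auto simp: normal_def)
  have "successively (\<lambda>x y. \<not> J x y) (C @ [x'])"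
    using 1(2) X' by (simp add: normal_def)
  \<comment> \<open>Normality of \<open>C @ [x']\<close>, known from \<open>c u\<close>, and of
    \<open>x' # X\<close> overlap in the letter \<open>x'\<close>; likewise the inverse parts
    overlap in \<open>y'\<close> below.\<close>
  then have s1: "successively (\<lambda>x y. \<not> J x y) (C @ x' # X)"
    using X(1) by (auto simp: succ)
  have "successively (\<lambda>x y. \<not> J y x) (E @ [y'])" "successively (\<lambda>x y. \<not> J y x) (y' # B)"
    using 3(2) D'' \<open>E' = [y']\<close> 2(2) Y' by (simp_all add: normal_def)
  then have s2: "successively (\<lambda>x y. \<not> J y x) (E @ y' # B)"
    by (auto simp: succ)
  \<comment> \<open>With \<open>D\<close> empty the junction is that of \<open>u b\<close>;
    otherwise it is the corner of the grid \<open>full\<close>.\<close>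
  have s3: "last (C @ x' # X) \<noteq> hd (E @ y' # B)"
  proof (cases "D = []")
    case True
    then have "E = []" "x # A' = x' # X" using full by (auto elim: grid_NilE)
    then show ?thesis using 2(2) Y' by (auto simp: normal_def)
  next
    case False
    then have "E \<noteq> []" using grid_length[OF full] by auto
    then show ?thesis using X(2) False by auto
  qed
  have N: "normal (C @ x' # X) (E @ y' # B)"
    using s1 s2 s3 P P' by (auto simp: normal_def)
  have "c \<otimes>\<^bsub>G\<^esub> u \<otimes>\<^bsub>G\<^esub> b = c \<otimes>\<^bsub>G\<^esub> (u \<otimes>\<^bsub>G\<^esub> b)" using c by (simp add: m_assoc)
  also have "\<dots> = cls (map Pos C @ (map Neg D @ map Pos (x # A')) @ map Neg (y' # B))"
    using P P' mult_cls[of "word C D" "word (x # A') (y' # B)"] 2(3) C(2) Y' by simp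
  also have "\<dots> = cls (map Pos C @ word (x' # X) E @ map Neg (y' # B))"
    using P P' by (intro steps_cls steps_context grid_steps full) auto
  finally have "shp (c \<otimes>\<^bsub>G\<^esub> u \<otimes>\<^bsub>G\<^esub> b) = (length (C @ x' # X), length (E @ y' # B))"
    using shp_normal[OF N] by simp
  then show ?thesis
    using C(3) B(3) s(1) grid_length[OF full] grid_length[OF 2(1)] by simp
qed

end


section \<open>Groups with a shape function\<close>

lemma le_one_prod: "(1, 1) \<le> n \<Longrightarrow> n = (1, 1) + (n - (1, 1))" for n :: "nat \<times> nat"
  by (cases n) (auto simp: less_eq_prod_def)

text \<open>The interface between the combinatorics and the category: inside this locale neither the
  plane nor normal forms occur. The definitions below copy the global maps, so that the two sets can
  be identified by unfolding.\<close>

locale shape_group = group G for G (structure) +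
  fixes \<delta> :: "'a \<Rightarrow> nat \<times> nat"
  assumes shape_one: "\<delta> \<one> = 0"
    and shape_length_le: "h \<in> carrier G \<Longrightarrow> k \<in> carrier G \<Longrightarrow>
          size_of (\<delta> (h \<otimes> k)) \<le> size_of (\<delta> h) + size_of (\<delta> k)"
    and shape_geodesic: "h \<in> carrier G \<Longrightarrow> k \<in> carrier G \<Longrightarrow>
          size_of (\<delta> (h \<otimes> k)) = size_of (\<delta> h) + size_of (\<delta> k) \<Longrightarrow>
          \<delta> (h \<otimes> k) = \<delta> h + \<delta> k"
    and shape_factor: "w \<in> carrier G \<Longrightarrow> \<delta> w = m + n \<Longrightarrow>
          \<exists>!(h, k). h \<in> carrier G \<and> k \<in> carrier G \<and> w = h \<otimes> k \<and> \<delta> h = m \<and> \<delta> k = n"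
    and shape_glue: "c \<in> carrier G \<Longrightarrow> u \<in> carrier G \<Longrightarrow> b \<in> carrier G \<Longrightarrow> \<delta> u = (1, 1) \<Longrightarrow>
          \<delta> (c \<otimes> u) = \<delta> c + \<delta> u \<Longrightarrow> \<delta> (u \<otimes> b) = \<delta> u + \<delta> b \<Longrightarrow>
          \<delta> (c \<otimes> u \<otimes> b) = \<delta> c + \<delta> u + \<delta> b"
begin

definition factors :: "nat \<times> nat \<Rightarrow> nat \<times> nat \<Rightarrow> 'a \<Rightarrow> 'a \<times> 'a" where
  "factors m n w = (THE (h, k). h \<in> carrier G \<and> k \<in> carrier G \<and> w = h \<otimes> k \<and> \<delta> h = m \<and> \<delta> k = n)"

definition "r w = fst (factors (1, 1) (\<delta> w - (1, 1)) w)"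
definition "b w = snd (factors (1, 1) (\<delta> w - (1, 1)) w)"
definition "c w = fst (factors (\<delta> w - (1, 1)) (1, 1) w)"
definition "s w = snd (factors (\<delta> w - (1, 1)) (1, 1) w)"
definition "d w = \<delta> w - (1, 1)"
definition "cmp v w = c v \<otimes> s v \<otimes> b w"
definition "Mor = {w \<in> carrier G. (1, 1) \<le> \<delta> w}"
definition "Obj = {w \<in> carrier G. \<delta> w = (1, 1)}"

lemma factors_eq:
  assumes "h \<in> carrier G" "k \<in> carrier G" "\<delta> h = m" "\<delta> k = n" "\<delta> (h \<otimes> k) = m + n"
  shows "factors m n (h \<otimes> k) = (h, k)"
  unfolding factors_def
proof (rule the1_equality)
  show "\<exists>!(h', k'). h' \<in> carrier G \<and> k' \<in> carrier G \<and> h \<otimes> k = h' \<otimes> k' \<and> \<delta> h' = m \<and> \<delta> k' = n"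
    by (rule shape_factor[OF m_closed[OF assms(1,2)] assms(5)])
qed (use assms in simp)

lemma factor_cancel:
  assumes "h \<in> carrier G" "k \<in> carrier G" "h' \<in> carrier G" "k' \<in> carrier G"
    and eq: "h \<otimes> k = h' \<otimes> k'" and shapes: "\<delta> h = \<delta> h'" "\<delta> k = \<delta> k'"
    and add: "\<delta> (h \<otimes> k) = \<delta> h + \<delta> k"
  shows "h = h' \<and> k = k'"
proof -
  have "factors (\<delta> h) (\<delta> k) (h \<otimes> k) = (h, k)"
    by (rule factors_eq[OF assms(1,2) HOL.refl HOL.refl add])
  moreover have "factors (\<delta> h) (\<delta> k) (h' \<otimes> k') = (h', k')"
    by (rule factors_eq[OF assms(3,4) shapes[symmetric] add[unfolded eq]])
  ultimately show ?thesis using eq by (metis prod.inject)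
qed

text \<open>Length is subadditive, so a geodesic triple product leaves no slack in either adjacent
  pair; \<open>shape_geodesic\<close> then makes the shapes add.\<close>

lemma shape_triple:
  assumes c: "x \<in> carrier G" "y \<in> carrier G" "z \<in> carrier G"
    and add: "\<delta> (x \<otimes> y \<otimes> z) = \<delta> x + \<delta> y + \<delta> z"
  shows "\<delta> (x \<otimes> y) = \<delta> x + \<delta> y" "\<delta> (y \<otimes> z) = \<delta> y + \<delta> z"
proof -
  have "\<delta> (x \<otimes> (y \<otimes> z)) = \<delta> x + \<delta> y + \<delta> z" using add c by (simp add: m_assoc)
  then show "\<delta> (y \<otimes> z) = \<delta> y + \<delta> z"
    using shape_length_le[of x "y \<otimes> z"] shape_length_le[of y z] c
    by (intro shape_geodesic) (auto simp: size_of_def)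
  show "\<delta> (x \<otimes> y) = \<delta> x + \<delta> y"
    using shape_length_le[of "x \<otimes> y" z] shape_length_le[of x y] c add
    by (intro shape_geodesic) (auto simp: size_of_def)
qed

lemma left_factor:
  assumes "w \<in> Mor"
  shows "r w \<in> Obj" "b w \<in> carrier G" "\<delta> w = (1, 1) + \<delta> (b w)" "r w \<otimes> b w = w"
proof -
  have w: "w \<in> carrier G" "\<delta> w = (1, 1) + (\<delta> w - (1, 1))"
    using assms le_one_prod by (auto simp: Mor_def)
  obtain h k where hk: "h \<in> carrier G" "k \<in> carrier G" "w = h \<otimes> k" "\<delta> h = (1, 1)" "\<delta> k = \<delta> w - (1, 1)"
    using shape_factor[OF w] by auto
  then have "r w = h" "b w = k"
    using factors_eq[of h k] w(2) by (simp_all add: r_def b_def)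
  then show "r w \<in> Obj" "b w \<in> carrier G" "\<delta> w = (1, 1) + \<delta> (b w)" "r w \<otimes> b w = w"
    using hk w by (simp_all add: Obj_def)
qed

lemma right_factor:
  assumes "w \<in> Mor"
  shows "s w \<in> Obj" "c w \<in> carrier G" "\<delta> w = \<delta> (c w) + (1, 1)" "c w \<otimes> s w = w"
proof -
  have w: "w \<in> carrier G" "\<delta> w = (\<delta> w - (1, 1)) + (1, 1)"
    using assms le_one_prod by (auto simp: Mor_def add.commute)
  obtain h k where hk: "h \<in> carrier G" "k \<in> carrier G" "w = h \<otimes> k" "\<delta> k = (1, 1)" "\<delta> h = \<delta> w - (1, 1)"
    using shape_factor[OF w] by auto
  then have "s w = k" "c w = h"
    using factors_eq[of h k] w(2) by (simp_all add: s_def c_def)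
  then show "s w \<in> Obj" "c w \<in> carrier G" "\<delta> w = \<delta> (c w) + (1, 1)" "c w \<otimes> s w = w"
    using hk w by (simp_all add: Obj_def)
qed

lemma shape_left:
  assumes "u \<in> Obj" "k \<in> carrier G" "\<delta> (u \<otimes> k) = (1, 1) + \<delta> k"
  shows "u \<otimes> k \<in> Mor" "r (u \<otimes> k) = u" "b (u \<otimes> k) = k"
  using assms factors_eq[of u k "(1, 1)" "\<delta> k"]
  by (auto simp: Mor_def Obj_def r_def b_def less_eq_prod_def)

lemma shape_right:
  assumes "u \<in> Obj" "h \<in> carrier G" "\<delta> (h \<otimes> u) = \<delta> h + (1, 1)"
  shows "h \<otimes> u \<in> Mor" "s (h \<otimes> u) = u" "c (h \<otimes> u) = h"
  using assms factors_eq[of h u "\<delta> h" "(1, 1)"]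
  by (auto simp: Mor_def Obj_def s_def c_def less_eq_prod_def)

text \<open>A geodesic group factorisation with an object in the middle becomes a factorisation in
  the category, the object \<open>u\<close> being shared by the two morphisms.\<close>

lemma triple:
  assumes c: "h \<in> carrier G" "u \<in> Obj" "k \<in> carrier G"
    and add: "\<delta> (h \<otimes> u \<otimes> k) = \<delta> h + (1, 1) + \<delta> k"
  shows "h \<otimes> u \<in> Mor" "u \<otimes> k \<in> Mor" "s (h \<otimes> u) = u" "r (u \<otimes> k) = u"
    "c (h \<otimes> u) = h" "b (u \<otimes> k) = k" "d (h \<otimes> u) = \<delta> h" "d (u \<otimes> k) = \<delta> k"
    "cmp (h \<otimes> u) (u \<otimes> k) = h \<otimes> u \<otimes> k"
proof -
  have u: "u \<in> carrier G" "\<delta> u = (1, 1)" using c by (auto simp: Obj_def)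
  have 1: "\<delta> (h \<otimes> u) = \<delta> h + (1, 1)" "\<delta> (u \<otimes> k) = (1, 1) + \<delta> k"
    using shape_triple[OF c(1) u(1) c(3)] add u by auto
  show *: "h \<otimes> u \<in> Mor" "s (h \<otimes> u) = u" "c (h \<otimes> u) = h"
    using shape_right c 1 by auto
  show **: "u \<otimes> k \<in> Mor" "r (u \<otimes> k) = u" "b (u \<otimes> k) = k"
    using shape_left c 1 by auto
  show "d (h \<otimes> u) = \<delta> h" "d (u \<otimes> k) = \<delta> k" using 1 by (simp_all add: d_def)
  show "cmp (h \<otimes> u) (u \<otimes> k) = h \<otimes> u \<otimes> k" by (simp add: cmp_def * **)
qed

section \<open>Composition, the category axioms and the cocycles\<close>

lemma Mor_carrier: "w \<in> Mor \<Longrightarrow> w \<in> carrier G"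
  by (simp add: Mor_def)

lemma cmp_eq: "l \<in> Mor \<Longrightarrow> cmp l m = l \<otimes> b m"
  using right_factor(4) by (simp add: cmp_def)

text \<open>Since \<open>s l = r m\<close>, both \<open>c l \<otimes> s l = l\<close> and
  \<open>s l \<otimes> b m = m\<close> have additive shape, so \<open>shape_glue\<close> applies
  with \<open>s l\<close> as the shared element.\<close>

lemma cmp_triple:
  assumes "l \<in> Mor" "m \<in> Mor" "s l = r m"
  shows "cmp l m = c l \<otimes> s l \<otimes> b m" "\<delta> (c l \<otimes> s l \<otimes> b m) = \<delta> (c l) + (1, 1) + \<delta> (b m)"
proof -
  show "cmp l m = c l \<otimes> s l \<otimes> b m" by (simp add: cmp_def)
  have u: "s l \<in> carrier G" "\<delta> (s l) = (1, 1)" using right_factor(1)[OF assms(1)] by (auto simp: Obj_def)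
  have "\<delta> (c l \<otimes> s l \<otimes> b m) = \<delta> (c l) + \<delta> (s l) + \<delta> (b m)"
    using right_factor[OF assms(1)] left_factor[OF assms(2)] u assms(3)
    by (intro shape_glue) auto
  then show "\<delta> (c l \<otimes> s l \<otimes> b m) = \<delta> (c l) + (1, 1) + \<delta> (b m)" using u by simp
qed

text \<open>The composite is read from both ends: \<open>r l \<otimes> b l \<otimes> b m\<close>
  yields its range and \<open>b\<close>, and \<open>c l \<otimes> c m \<otimes> s m\<close> yields
  its source and \<open>c\<close>. The cocycle identities are these two formulas.\<close>

lemma cmp_props:
  assumes l: "l \<in> Mor" and m: "m \<in> Mor" and lm: "s l = r m"
  shows "cmp l m \<in> Mor" "r (cmp l m) = r l" "s (cmp l m) = s m"
    "b (cmp l m) = b l \<otimes> b m" "c (cmp l m) = c l \<otimes> c m" "d (cmp l m) = d l + d m"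
proof -
  note L = left_factor[OF l] right_factor[OF l] and M = left_factor[OF m] right_factor[OF m]
  have o: "r l \<in> carrier G" "s l \<in> carrier G" "r m \<in> carrier G" "s m \<in> carrier G"
      "\<delta> (r l) = (1, 1)" "\<delta> (s m) = (1, 1)"
    using L M by (simp_all add: Obj_def)
  have shape: "\<delta> (cmp l m) = \<delta> (c l) + (1, 1) + \<delta> (b m)"
    using cmp_triple[OF l m lm] by simp
  \<comment> \<open>Both shapes are \<open>\<delta> l\<close> with \<open>(1, 1)\<close> removed,
    which lets one shape count serve both readings.\<close>
  have bl: "\<delta> (c l) = \<delta> (b l)" using L(3,7) by (simp add: add.commute)
  have cm: "\<delta> (c m) = \<delta> (b m)" using M(3,7) by (simp add: add.commute)
  have left: "cmp l m = r l \<otimes> b l \<otimes> b m" using cmp_eq[OF l] L by simp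
  then have "\<delta> (r l \<otimes> b l \<otimes> b m) = \<delta> (r l) + \<delta> (b l) + \<delta> (b m)"
    using shape bl o by (simp add: add.commute)
  then have 1: "\<delta> (b l \<otimes> b m) = \<delta> (b l) + \<delta> (b m)"
    using shape_triple(2) o L M by blast
  have "cmp l m = r l \<otimes> (b l \<otimes> b m)" by (simp add: left m_assoc[OF o(1) L(2) M(2)])
  moreover have "\<delta> (r l \<otimes> (b l \<otimes> b m)) = (1, 1) + \<delta> (b l \<otimes> b m)"
    using shape 1 bl calculation by (simp add: ac_simps)
  ultimately show "cmp l m \<in> Mor" "r (cmp l m) = r l" "b (cmp l m) = b l \<otimes> b m"
    using shape_left[OF L(1), of "b l \<otimes> b m"] L M by simp_all
  have "cmp l m = c l \<otimes> (r m \<otimes> b m)"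
    using lm m_assoc[OF L(6) o(3) M(2)] by (simp add: cmp_def)
  then have right: "cmp l m = c l \<otimes> c m \<otimes> s m"
    using m_assoc[OF L(6) M(6) o(4)] M(4,8) by simp
  then have "\<delta> (c l \<otimes> c m \<otimes> s m) = \<delta> (c l) + \<delta> (c m) + \<delta> (s m)"
    using shape cm o by (simp add: ac_simps)
  then have 2: "\<delta> (c l \<otimes> c m) = \<delta> (c l) + \<delta> (c m)"
    using shape_triple(1) o L M by blast
  have "\<delta> (c l \<otimes> c m \<otimes> s m) = \<delta> (c l \<otimes> c m) + (1, 1)"
    using shape 2 cm right by (simp add: ac_simps)
  then show "s (cmp l m) = s m" "c (cmp l m) = c l \<otimes> c m"
    using shape_right[OF M(5), of "c l \<otimes> c m"] L M right by simp_all
  show "d (cmp l m) = d l + d m"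
    using shape L(7) M(3) by (simp add: d_def ac_simps)
qed

lemma Obj_props:
  assumes "v \<in> Obj"
  shows "v \<in> Mor" "r v = v" "s v = v" "b v = \<one>" "c v = \<one>" "d v = 0"
proof -
  have v: "v \<in> carrier G" "\<delta> v = (1, 1)" using assms by (simp_all add: Obj_def)
  show "v \<in> Mor" "r v = v" "s v = v" "b v = \<one>" "c v = \<one>"
    using shape_left[OF assms, of "\<one>"] shape_right[OF assms, of "\<one>"] v shape_one by simp_all
  show "d v = 0" using v by (simp add: d_def)
qed

lemma small_category_Mor: "small_category Mor Obj r s cmp"
proof
  show "cmp (cmp l m) n = cmp l (cmp m n)"
    if "l \<in> Mor" "m \<in> Mor" "n \<in> Mor" "s l = r m" "s m = r n" for l m n
    using that cmp_props[of l m] cmp_props[of m n] left_factor[of m] left_factor[of n] Mor_carrier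
    by (simp add: cmp_eq m_assoc)
  show "cmp (r l) l = l" if "l \<in> Mor" for l
    using left_factor[OF that] Obj_props cmp_eq by simp
  show "cmp l (s l) = l" if "l \<in> Mor" for l
    using right_factor[OF that] Obj_props cmp_eq Mor_carrier that by simp
qed (use left_factor right_factor Obj_props cmp_props in auto)

lemma two_graph_Mor: "two_graph Mor Obj r s cmp d"
proof -
  interpret small_category Mor Obj r s cmp by (rule small_category_Mor)
  show ?thesis
  proof
    fix l p q
    assume l: "l \<in> Mor" and pq: "d l = p + q"
    \<comment> \<open>The degree is the shape less \<open>(1, 1)\<close>, so one unit
      \<open>(1, 1)\<close> is left between \<open>p\<close> and \<open>q\<close>; it is the shape
      of the object at which \<open>l\<close> is cut.\<close>
    have lc: "l \<in> carrier G" and shape: "\<delta> l = p + ((1, 1) + q)"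
      using l pq left_factor(3)[OF l] by (auto simp: Mor_def d_def ac_simps)
    obtain h w where hw: "h \<in> carrier G" "w \<in> carrier G" "l = h \<otimes> w" "\<delta> h = p" "\<delta> w = (1, 1) + q"
      using shape_factor[OF lc shape] by auto
    obtain u k where uk: "u \<in> carrier G" "k \<in> carrier G" "w = u \<otimes> k" "\<delta> u = (1, 1)" "\<delta> k = q"
      using shape_factor[OF hw(2,5)] by auto
    have luk: "l = h \<otimes> u \<otimes> k" using hw uk by (simp add: m_assoc)
    have uO: "u \<in> Obj" using uk by (simp add: Obj_def)
    have add: "\<delta> (h \<otimes> u \<otimes> k) = \<delta> h + (1, 1) + \<delta> k"
      using luk shape hw uk by (simp add: ac_simps)
    note T = triple[OF hw(1) uO uk(2) add]
    show "\<exists>!(m, n). m \<in> Mor \<and> n \<in> Mor \<and> s m = r n \<and> d m = p \<and> d n = q \<and> l = cmp m n"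
    proof (rule ex1I[of _ "(h \<otimes> u, u \<otimes> k)"], goal_cases)
      case 1
      then show ?case using T hw uk luk by simp
    next
      case (2 mn)
      obtain m n where mn: "mn = (m, n)" by (cases mn)
      with 2 have mn': "m \<in> Mor" "n \<in> Mor" "s m = r n" "d m = p" "d n = q" "l = cmp m n" by auto
      note M = right_factor[OF mn'(1)] and N = left_factor[OF mn'(2)]
      have sh: "\<delta> (c m) = p" "\<delta> (b n) = q" using M(3) N(3) mn' by (auto simp: d_def)
      have nc: "n \<in> carrier G" "m \<in> carrier G" using mn' Mor_carrier by auto
      have so: "s m \<in> carrier G" "\<delta> (s m) = (1, 1)" using M by (auto simp: Obj_def)
      \<comment> \<open>Uniqueness of factorisation in the group is used twice: first for
        \<open>l\<close> cut into \<open>c m\<close> and \<open>n\<close>, then for \<open>n\<close>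
        cut into \<open>r n\<close> and \<open>b n\<close>.\<close>
      have "l = c m \<otimes> n"
        using mn'(3,6) m_assoc[OF M(2) so(1) N(2)] N(4) by (simp add: cmp_def)
      then have hn: "h = c m" "w = n"
        using factor_cancel[OF hw(1,2) M(2) nc(1)] hw(3-5) shape sh N(3) by auto
      have "\<delta> w = \<delta> u + \<delta> k" using hw(5) uk(4,5) by simp
      then have "u = r n" "k = b n"
        using factor_cancel[OF uk(1,2) so(1)[unfolded mn'(3)] N(2)] uk(3-5) N(4) sh so(2) mn'(3) hn(2)
        by auto
      then show ?case using hn M(4) N(4) mn'(3) mn by simp
    qed
  qed (use Obj_props cmp_props in auto)
qed

lemma one_cocycle_b: "one_cocycle Mor Obj r s cmp G b"
proof -
  interpret small_category Mor Obj r s cmp by (rule small_category_Mor)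
  show ?thesis by unfold_locales (use left_factor Obj_props cmp_props in auto)
qed

lemma one_cocycle_c: "one_cocycle Mor Obj r s cmp G c"
proof -
  interpret small_category Mor Obj r s cmp by (rule small_category_Mor)
  show ?thesis by unfold_locales (use right_factor Obj_props cmp_props in auto)
qed

end


section \<open>The group of a triella\<close>

context triangle_presentation
begin

lemma inv_cls_Pos: "y \<in> P \<Longrightarrow> inv\<^bsub>G\<^esub> (cls [Pos y]) = cls [Neg y]"
proof -
  assume y: "y \<in> P"
  interpret group G by (rule group_G)
  have "cls [Neg y] \<otimes>\<^bsub>G\<^esub> cls [Pos y] = cls ([Neg y] @ [Pos y])"
    using y by (intro mult_cls) auto
  also have "\<dots> = \<one>\<^bsub>G\<^esub>"
    using y by (simp add: one_G cls_eq_iff pres_eq.neg_pos)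
  finally show ?thesis using y by (intro inv_equality) auto
qed

lemma foldr_mult_letters:
  "w \<in> words P \<Longrightarrow> foldr (\<otimes>\<^bsub>G\<^esub>) (map (\<lambda>a. cls [a]) w) \<one>\<^bsub>G\<^esub> = cls w"
proof (induction w)
  case (Cons a w)
  then have "[a] \<in> words P" "w \<in> words P" by (auto simp: words_def)
  then show ?case using Cons mult_cls[of "[a]" w] by simp
qed (simp add: one_G)

lemma normal_word_eq:
  assumes "set xs \<subseteq> P" "set ys \<subseteq> P"
  shows "normal_word P T xs ys = cls (word xs ys)"
proof -
  have eq: "map (tri_gen P T) xs @ map (\<lambda>y. inv\<^bsub>G\<^esub> (tri_gen P T y)) ys = map (\<lambda>a. cls [a]) (word xs ys)"
    using assms inv_cls_Pos by (auto simp: tri_gen_def cls_def)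
  show ?thesis
    unfolding normal_word_def Let_def eq by (rule foldr_mult_letters) (simp add: assms)
qed

text \<open>Once \<open>J\<close> is incidence on \<open>P\<close>, the two definite descriptions
  range over the same normal forms.\<close>

lemma shape_eq_shp:
  assumes "\<And>x y. x \<in> P \<Longrightarrow> y \<in> P \<Longrightarrow> J x y \<longleftrightarrow> I y (lam x)"
  shows "shape P I lam T = shp"
proof -
  have "right_normal P I lam xs ys \<longleftrightarrow> normal xs ys" for xs ys
  proof (cases "set xs \<subseteq> P \<and> set ys \<subseteq> P")
    case True
    then have "J (xs ! i) (xs ! Suc i) \<longleftrightarrow> I (xs ! Suc i) (lam (xs ! i))" if "Suc i < length xs" for i
      using that assms by (simp add: subset_iff)
    moreover have "J (ys ! Suc j) (ys ! j) \<longleftrightarrow> I (ys ! j) (lam (ys ! Suc j))" if "Suc j < length ys" for j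
      using that True assms by (simp add: subset_iff)
    ultimately show ?thesis
      using True unfolding right_normal_def normal_def successively_conv_nth by blast
  qed (auto simp: right_normal_def normal_def)
  then have "(right_normal P I lam xs ys \<and> w = normal_word P T xs ys) \<longleftrightarrow>
      (normal xs ys \<and> w = cls (word xs ys))" for xs ys w
    using normal_word_eq normal_in_P by metis
  \<comment> \<open>\<open>Q\<close> stands for the equation about \<open>mn\<close> in both
    descriptions.\<close>
  then have "(right_normal P I lam xs ys \<and> w = normal_word P T xs ys \<and> Q) \<longleftrightarrow>
      (normal xs ys \<and> w = cls (word xs ys) \<and> Q)" for xs ys w Q
    by blast
  then show ?thesis
    unfolding fun_eq_iff shape_def shp_def by presburger
qed

lemma shape_group_shp: "shape_group G shp"
  by (intro shape_group.intro shape_group_axioms.intro group_G)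
    (fact shp_one shp_mult factorisation_ex1 shp_glue)+

end

text \<open>The axioms of the plane are pulled back along \<open>lam\<close>: injectivity makes
  distinct points index distinct lines, and surjectivity indexes the line joining two
  points.\<close>

lemma triangle_presentation_triella:
  assumes plane: "projective_plane P L I q" and lam: "bij_betw lam P L" and tri: "triella P I lam T"
  shows "triangle_presentation P T"
    and "\<And>x y. x \<in> P \<Longrightarrow> y \<in> P \<Longrightarrow> (\<exists>z. (x, y, z) \<in> T) \<longleftrightarrow> I y (lam x)"
proof -
  have TP: "T \<subseteq> P \<times> P \<times> P"
    and T1: "\<forall>x\<in>P. \<forall>y\<in>P. (\<exists>z\<in>P. (x, y, z) \<in> T) \<longleftrightarrow> I y (lam x)"
    and T2: "\<forall>x y z. (x, y, z) \<in> T \<longrightarrow> (y, z, x) \<in> T"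
    and T3: "\<forall>x\<in>P. \<forall>y\<in>P. \<forall>z\<in>P. \<forall>z'\<in>P. (x, y, z) \<in> T \<longrightarrow> (x, y, z') \<in> T \<longrightarrow> z = z'"
    using tri unfolding triella_def by - (elim conjE, assumption)+
  have sub: "x \<in> P \<and> y \<in> P \<and> z \<in> P" if "(x, y, z) \<in> T" for x y z
    using TP that by auto
  show inc: "(\<exists>z. (x, y, z) \<in> T) \<longleftrightarrow> I y (lam x)" if "x \<in> P" "y \<in> P" for x y
    using T1 that sub by meson
  have lamL: "lam x \<in> L" if "x \<in> P" for x using lam that by (auto dest: bij_betwE)
  have lam_eq: "lam x = lam x' \<longleftrightarrow> x = x'" if "x \<in> P" "x' \<in> P" for x x'
    using lam that by (auto simp: bij_betw_def inj_on_def)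
  have PL: "\<forall>x\<in>P. \<forall>y\<in>P. x \<noteq> y \<longrightarrow> (\<exists>!l. l \<in> L \<and> I x l \<and> I y l)"
    and LP: "\<forall>k\<in>L. \<forall>l\<in>L. k \<noteq> l \<longrightarrow> (\<exists>!x. x \<in> P \<and> I x k \<and> I x l)"
    using plane unfolding projective_plane_def by - (elim conjE, assumption)+
  have pt: "\<exists>!u. u \<in> P \<and> I u k \<and> I u l" if "k \<in> L" "l \<in> L" "k \<noteq> l" for k l
    using LP that by blast
  have ln: "\<exists>l. l \<in> L \<and> I y l \<and> I y' l" if "y \<in> P" "y' \<in> P" "y \<noteq> y'" for y y'
    using PL that by blast
  show "triangle_presentation P T"
  proof
    show "(y, z, x) \<in> T" if "(x, y, z) \<in> T" for x y z
      using T2 that by blast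
    show "z = z'" if "(x, y, z) \<in> T" "(x, y, z') \<in> T" for x y z z'
      using T3 sub[OF that(1)] sub[OF that(2)] that by blast
    show "\<exists>u z z'. (x, u, z) \<in> T \<and> (x', u, z') \<in> T" if "x \<in> P" "x' \<in> P" "x \<noteq> x'" for x x'
    proof -
      obtain u where "u \<in> P" "I u (lam x)" "I u (lam x')"
        using pt[of "lam x" "lam x'"] lamL lam_eq \<open>x \<in> P\<close> \<open>x' \<in> P\<close> \<open>x \<noteq> x'\<close> by blast
      then show ?thesis using inc that by blast
    qed
    show "\<exists>u z z'. (u, y, z) \<in> T \<and> (u, y', z') \<in> T" if "y \<in> P" "y' \<in> P" "y \<noteq> y'" for y y'
    proof -
      obtain l where l: "l \<in> L" "I y l" "I y' l" using ln \<open>y \<in> P\<close> \<open>y' \<in> P\<close> \<open>y \<noteq> y'\<close> by blast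
      then obtain u where "u \<in> P" "l = lam u" using lam by (auto simp: bij_betw_def)
      then show ?thesis using inc l that by blast
    qed
    show "x = x' \<or> u = v"
      if "(x, u, z1) \<in> T" "(x', u, z2) \<in> T" "(x, v, z3) \<in> T" "(x', v, z4) \<in> T" for x x' u v z1 z2 z3 z4
    proof (rule disjCI)
      assume "u \<noteq> v"
      have P: "x \<in> P" "x' \<in> P" "u \<in> P" "v \<in> P" using sub[OF that(1)] sub[OF that(4)] by blast+
      then have "I u (lam x)" "I u (lam x')" "I v (lam x)" "I v (lam x')"
        using inc[of x u] inc[of x' u] inc[of x v] inc[of x' v] that by blast+
      then have "lam x = lam x'" using pt[of "lam x" "lam x'"] lamL P \<open>u \<noteq> v\<close> by blast
      then show "x = x'" using lam_eq P by blast
    qed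
  qed (use sub in blast)
qed

theorem theorem5p17:
  fixes P :: "'p set" and L :: "'l set" and I :: "'p \<Rightarrow> 'l \<Rightarrow> bool" and q :: nat
    and lam :: "'p \<Rightarrow> 'l" and T :: "('p \<times> 'p \<times> 'p) set"
  assumes "projective_plane P L I q"
    and "bij_betw lam P L"
    and "triella P I lam T"
  shows "two_graph (Lam P I lam T) (Lam0 P I lam T) (r_map P I lam T) (s_map P I lam T)
           (comp_map P I lam T) (deg P I lam T)
       \<and> one_cocycle (Lam P I lam T) (Lam0 P I lam T) (r_map P I lam T) (s_map P I lam T)
           (comp_map P I lam T) (tri_group P T) (b_map P I lam T)
       \<and> one_cocycle (Lam P I lam T) (Lam0 P I lam T) (r_map P I lam T) (s_map P I lam T)
           (comp_map P I lam T) (tri_group P T) (c_map P I lam T)"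
proof -
  interpret TP: triangle_presentation P T
    using triangle_presentation_triella(1) assms .
  have "TP.J x y \<longleftrightarrow> I y (lam x)" if "x \<in> P" "y \<in> P" for x y
    using triangle_presentation_triella(2)[OF assms that] unfolding TP.J_def .
  then have "shape P I lam T = TP.shp" by (rule TP.shape_eq_shp)
  then interpret S: shape_group "tri_group P T" "shape P I lam T"
    using TP.shape_group_shp by simp
  \<comment> \<open>The locale constants and the global maps have matching definitions;
    \<open>factors\<close> comes first because the four maps are projections of it.\<close>
  have fac: "S.factors = shape_factors P I lam T"
    by (intro ext) (simp add: S.factors_def shape_factors_def)
  have maps: "S.r = r_map P I lam T" "S.s = s_map P I lam T" "S.b = b_map P I lam T"
      "S.c = c_map P I lam T"
    by (intro ext, simp add: fac S.r_def S.s_def S.b_def S.c_def r_map_def s_map_def b_map_def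
        c_map_def)+
  moreover have "S.cmp = comp_map P I lam T"
    by (intro ext) (simp add: S.cmp_def comp_map_def maps)
  moreover have "S.d = deg P I lam T" "S.Mor = Lam P I lam T" "S.Obj = Lam0 P I lam T"
    by (auto simp: S.d_def deg_def S.Mor_def Lam_def S.Obj_def Lam0_def)
  ultimately show ?thesis
    using S.two_graph_Mor S.one_cocycle_b S.one_cocycle_c by simp
qed

end
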